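(* Let $n,k$ be integers of opposite parity with $1\leq k\leq n-1$. Then there exists an integer $l\geq 0$ such that one of the following two cases holds, with the corresponding homotopy equivalence: $$I(T_{n,k})\simeq\begin{cases}\bigvee^{k} S^{2l} & \text{if } n=(2l+1)(k+1),\\[2pt] S^{2l+1} & \text{if } 2l+1<\frac{n}{k+1}<2l+3.\end{cases}$$
   Context: For integers $n,k$ of opposite parity with $1\leq k\leq n-1$ put $r=\frac{n-k-1}{2}$. The graph $T_{n,k}$ (a circular complete graph) has vertex set $\mathbb{Z}/n$, and each vertex $i$ is adjacent exactly to the $k$ vertices $i+r+1,\ldots,i+r+k \pmod n$ (the $k$ "most opposite" vertices of the regular $n$-gon). The independence complex $I(G)$ of a graph $G$ is the simplicial complex on $V(G)$ whose simplices are the independent sets of $G$. $\bigvee^k X$ is a wedge of $k$ copies of $X$. *)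

theory Defs
  imports "HOL-Analysis.Analysis"
begin

text \<open>
  The vertex set \<open>\<int>/n\<close> is represented by \<open>{..<n}\<close>, and graphs are given by a vertex set together
  with an adjacency relation. For \<open>k < n\<close> with \<open>n\<close> and \<open>k\<close> of opposite parity, the truncated
  subtraction and the division by 2 below are exact.
\<close>

definition circular_adj :: "nat \<Rightarrow> nat \<Rightarrow> nat \<Rightarrow> nat \<Rightarrow> bool" where
  "circular_adj n k i j \<longleftrightarrow> (\<exists>s\<in>{1..k}. j = (i + (n - k - 1) div 2 + s) mod n)"

definition independence_complex :: "'a set \<Rightarrow> ('a \<Rightarrow> 'a \<Rightarrow> bool) \<Rightarrow> 'a set set" where
  "independence_complex V E = {S. finite S \<and> S \<subseteq> V \<and> (\<forall>u\<in>S. \<forall>v\<in>S. \<not> E u v)}"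

text \<open>
  Points of the geometric realization are given by their barycentric coordinates. The empty simplex
  contributes no point, since its coordinates would sum to 0. The subspace topology used here is
  the usual one when \<open>K\<close> is finite; for infinite complexes it is coarser than the weak topology
  in general.
\<close>

definition geom_realization :: "'a set set \<Rightarrow> ('a \<Rightarrow> real) topology" where
  "geom_realization K = subtopology (powertop_real UNIV)
     {x. {v. x v \<noteq> 0} \<in> K \<and> (\<forall>v. 0 \<le> x v) \<and> (\<Sum>v\<in>{v. x v \<noteq> 0}. x v) = 1}"

definition quotient_topology :: "'a topology \<Rightarrow> ('a \<Rightarrow> 'b) \<Rightarrow> 'b topology" where
  "quotient_topology X f =
     topology (\<lambda>U. U \<subseteq> f ` topspace X \<and> openin X {x \<in> topspace X. f x \<in> U})"

lemma openin_quotient_topology: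
  "openin (quotient_topology X f) U \<longleftrightarrow>
     U \<subseteq> f ` topspace X \<and> openin X {x \<in> topspace X. f x \<in> U}"
proof -
  have "istopology (\<lambda>U. U \<subseteq> f ` topspace X \<and> openin X {x \<in> topspace X. f x \<in> U})"
    unfolding istopology_def
  proof (intro conjI allI impI)
    fix S T
    assume "S \<subseteq> f ` topspace X \<and> openin X {x \<in> topspace X. f x \<in> S}"
      and "T \<subseteq> f ` topspace X \<and> openin X {x \<in> topspace X. f x \<in> T}"
    moreover have "{x \<in> topspace X. f x \<in> S \<inter> T} =
        {x \<in> topspace X. f x \<in> S} \<inter> {x \<in> topspace X. f x \<in> T}"
      by auto
    ultimately show "S \<inter> T \<subseteq> f ` topspace X" "openin X {x \<in> topspace X. f x \<in> S \<inter> T}"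
      by auto
  next
    fix \<K>
    assume *: "\<forall>K\<in>\<K>. K \<subseteq> f ` topspace X \<and> openin X {x \<in> topspace X. f x \<in> K}"
    then show "\<Union>\<K> \<subseteq> f ` topspace X"
      by blast
    have "{x \<in> topspace X. f x \<in> \<Union>\<K>} = (\<Union>K\<in>\<K>. {x \<in> topspace X. f x \<in> K})"
      by auto
    then show "openin X {x \<in> topspace X. f x \<in> \<Union>\<K>}"
      using * by auto
  qed
  then show ?thesis
    by (simp add: quotient_topology_def)
qed

lemma topspace_quotient_topology: "topspace (quotient_topology X f) = f ` topspace X"
proof
  show "topspace (quotient_topology X f) \<subseteq> f ` topspace X"
    using openin_topspace[of "quotient_topology X f"] unfolding openin_quotient_topology
    by (rule conjunct1)
  have "{x \<in> topspace X. f x \<in> f ` topspace X} = topspace X"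
    by auto
  then have "openin (quotient_topology X f) (f ` topspace X)"
    by (simp add: openin_quotient_topology)
  then show "f ` topspace X \<subseteq> topspace (quotient_topology X f)"
    by (rule openin_subset)
qed

lemma quotient_map_quotient_topology: "quotient_map X (quotient_topology X f) f"
  by (simp add: quotient_map_def openin_quotient_topology topspace_quotient_topology)

text \<open>
  The wedge, over a nonempty index set \<open>I\<close>, of the spaces \<open>X i\<close> with base points \<open>p i\<close>: in the
  disjoint union all base points are collapsed to the single point \<open>None\<close>.
\<close>

definition wedge :: "('i \<Rightarrow> 'a topology) \<Rightarrow> ('i \<Rightarrow> 'a) \<Rightarrow> 'i set \<Rightarrow> ('i \<times> 'a) option topology" where
  "wedge X p I = quotient_topology (sum_topology X I)
     (\<lambda>(i, x). if x = p i then None else Some (i, x))"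

definition sphere_basepoint :: "nat \<Rightarrow> real" where
  "sphere_basepoint = (\<lambda>i. if i = 0 then 1 else 0)"

lemma sphere_basepoint_in_nsphere: "sphere_basepoint \<in> topspace (nsphere d)"
proof -
  have "(\<Sum>i\<le>d. (sphere_basepoint i)\<^sup>2) = (\<Sum>i\<le>d. if i = 0 then 1 else 0)"
    by (intro sum.cong) (auto simp: sphere_basepoint_def)
  then show ?thesis
    by (simp add: nsphere sphere_basepoint_def)
qed

definition wedge_of_spheres :: "nat \<Rightarrow> nat \<Rightarrow> (nat \<times> (nat \<Rightarrow> real)) option topology" where
  "wedge_of_spheres k d = wedge (\<lambda>_. nsphere d) (\<lambda>_. sphere_basepoint) {..<k}"

end

theory Submission
  imports Defs
begin

text \<open>
  Write \<open>n = 2r + k + 1\<close>; then vertices \<open>u < v\<close> are adjacent iff \<open>r < v - u \<le> r + k\<close>. The only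
  combinatorial move is the removal of the open star of a simplex whose closed star is a cone with
  apex outside the simplex, which is a deformation retraction. If the neighbourhood \<open>B\<close> of a vertex
  \<open>w\<close> is independent, such moves turn the independence complex into the suspension of the complex of
  those independent sets outside \<open>B \<union> {w}\<close> that leave some vertex of \<open>B\<close> non-adjacent to all of
  them. For \<open>r > k\<close>, doing this twice replaces \<open>r\<close> by \<open>r - k - 1\<close>: the first step gives a
  bipartite circular graph on \<open>r + r\<close> vertices, the second a circular graph again. The recursion
  ends at \<open>r = 0\<close>, where the complex consists of \<open>k + 1\<close> points, or at \<open>1 \<le> r \<le> k\<close>, where it
  collapses to a 4-cycle. An iterated suspension of \<open>k + 1\<close> points consists of \<open>k + 1\<close> discs glued
  along their common boundary, and collapsing the last disc gives a wedge of \<open>k\<close> spheres.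
\<close>

subsection \<open>Homotopies between geometric realizations\<close>

text \<open>The recursion repeatedly suspends complexes that are known only up to homotopy.
  Suspending an arbitrary homotopy equivalence would require joins of continuous maps and of
  homotopies. This is avoided by recording collapses as a relation \<open>collapse_equiv\<close>
  between complexes: a collapse of \<open>K\<close> at \<open>\<sigma>\<close> is at the same time a
  collapse of every suspension of \<open>K\<close>. Explicit maps are needed only for a single
  collapse, for injective relabellings, and for the two final comparisons with spheres. The
  \<open>m\<close>-fold suspension is one complex with parameter \<open>m\<close>, so that further
  suspensions raise \<open>m\<close> and do not nest vertex types. The empty simplex belongs to
  every nonempty complex; \<open>{{}}\<close> has empty realization and acts as the sphere of
  dimension -1, from which the spheres arise by suspension.\<close>

definition finite_complex :: "'a set set \<Rightarrow> bool" where
  "finite_complex K \<longleftrightarrow> finite (\<Union>K) \<and> (\<forall>S\<in>K. \<forall>T. T \<subseteq> S \<longrightarrow> T \<in> K)"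

abbreviation supp :: "('a \<Rightarrow> real) \<Rightarrow> 'a set" where
  "supp x \<equiv> {v. x v \<noteq> 0}"

lemma topspace_geom_realization:
  "topspace (geom_realization K) = {x. supp x \<in> K \<and> (\<forall>v. 0 \<le> x v) \<and> sum x (supp x) = 1}"
  by (simp add: geom_realization_def)

lemma geom_realization_eq_0:
  assumes "x \<in> topspace (geom_realization K)" "v \<notin> \<Union>K"
  shows "x v = 0"
proof (rule ccontr)
  assume "x v \<noteq> 0"
  moreover have "supp x \<in> K"
    using assms(1) by (simp add: topspace_geom_realization)
  ultimately show False
    using assms(2) by blast
qed

text \<open>The sum in \<open>geom_realization\<close> runs over the support, which varies with the
  point. Over a fixed finite set the same sum is linear in the point, as the constructions of maps
  below require.\<close>

lemma in_geom_realization_iff: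
  assumes "finite A" "\<Union>K \<subseteq> A"
  shows "x \<in> topspace (geom_realization K) \<longleftrightarrow> supp x \<in> K \<and> (\<forall>v. 0 \<le> x v) \<and> sum x A = 1"
proof -
  have "sum x (supp x) = sum x A" if "supp x \<in> K"
    using assms that by (intro sum.mono_neutral_left) auto
  then show ?thesis
    by (auto simp: topspace_geom_realization)
qed

lemma continuous_map_into_geom_realization:
  "continuous_map X (geom_realization K) f \<longleftrightarrow>
     (\<forall>v. continuous_map X euclideanreal (\<lambda>x. f x v)) \<and>
     (\<forall>x\<in>topspace X. f x \<in> topspace (geom_realization K))"
  unfolding geom_realization_def continuous_map_in_subtopology continuous_map_componentwise_UNIV
  by (auto simp: image_subset_iff)

lemma continuous_map_geom_realization_coordinate:
  "continuous_map (geom_realization K) euclideanreal (\<lambda>x. x v)"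
  unfolding geom_realization_def by (intro continuous_intros) auto

lemma continuous_map_real_Min:
  assumes "finite I" "I \<noteq> {}" "\<And>i. i \<in> I \<Longrightarrow> continuous_map X euclideanreal (\<lambda>x. f x i)"
  shows "continuous_map X euclideanreal (\<lambda>x. Min (f x ` I))"
  using assms
proof (induction I rule: finite_ne_induct)
  case (insert i I)
  then have "continuous_map X euclideanreal (\<lambda>x. min (f x i) (Min (f x ` I)))"
    by (intro continuous_map_real_min) auto
  then show ?case
    using insert by simp
qed auto

text \<open>Along the segment from \<open>f x\<close> to \<open>g x\<close> the support stays inside
  the union of the two supports, and the coordinate sum is affine. So the segment never leaves the
  realization.\<close>

lemma homotopic_straight_line_geom_realization:
  assumes K: "finite_complex K"
    and f: "continuous_map X (geom_realization K) f"
    and g: "continuous_map X (geom_realization K) g"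
    and carrier: "\<And>x. x \<in> topspace X \<Longrightarrow> supp (f x) \<union> supp (g x) \<in> K"
  shows "homotopic_with (\<lambda>_. True) X (geom_realization K) f g"
proof -
  define h where "h = (\<lambda>(t::real, x) v. (1 - t) * f x v + t * g x v)"
  have coord: "continuous_map X euclideanreal (\<lambda>x. f x v)" "continuous_map X euclideanreal (\<lambda>x. g x v)" for v
    using f g by (auto simp: continuous_map_into_geom_realization)
  have "continuous_map (prod_topology (top_of_set {0..1}) X) (geom_realization K) h"
    unfolding continuous_map_into_geom_realization
  proof (intro conjI allI ballI)
    fix v
    have "continuous_map (prod_topology (top_of_set {0..1::real}) X) euclideanreal
        (\<lambda>p. (1 - fst p) * f (snd p) v + fst p * g (snd p) v)"
      using coord by (intro continuous_intros continuous_map_compose[OF continuous_map_snd, unfolded o_def]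
          continuous_map_into_fulltopology[OF continuous_map_fst]) auto
    then show "continuous_map (prod_topology (top_of_set {0..1}) X) euclideanreal (\<lambda>p. h p v)"
      by (simp add: h_def case_prod_unfold)
  next
    fix p assume "p \<in> topspace (prod_topology (top_of_set {0..1::real}) X)"
    then obtain t x where p: "p = (t, x)" "0 \<le> t" "t \<le> 1" "x \<in> topspace X"
      by auto
    have fin: "finite (\<Union>K)"
      using K by (simp add: finite_complex_def)
    have fx: "f x \<in> topspace (geom_realization K)" "g x \<in> topspace (geom_realization K)"
      using f g p continuous_map_image_subset_topspace by fastforce+
    have "supp (h p) \<subseteq> supp (f x) \<union> supp (g x)"
      by (auto simp: h_def p)
    then have "supp (h p) \<in> K"
      using carrier[OF p(4)] K unfolding finite_complex_def by blast
    moreover have "sum (h p) (\<Union>K) = (1 - t) * sum (f x) (\<Union>K) + t * sum (g x) (\<Union>K)"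
      by (simp add: h_def p sum.distrib sum_distrib_left)
    ultimately show "h p \<in> topspace (geom_realization K)"
      using fx p by (auto simp: in_geom_realization_iff[OF fin order_refl] h_def)
  qed
  then show ?thesis
    unfolding homotopic_with_def by (intro exI[of _ h]) (auto simp: h_def)
qed

text \<open>The retraction \<open>f\<close> takes the smallest weight \<open>m x\<close> on
  \<open>\<sigma>\<close> away from each vertex of \<open>\<sigma>\<close> and gives the total to
  \<open>w\<close>. The minimum is attained, so some vertex of \<open>\<sigma>\<close> leaves the
  support; if \<open>\<sigma>\<close> is not contained in the support of \<open>x\<close>, then
  \<open>m x = 0\<close> and \<open>x\<close> is fixed. By the cone hypothesis \<open>x\<close> and
  \<open>f x\<close> lie in a common simplex, so \<open>f\<close> is joined to the identity by
  segments.\<close>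

lemma homotopy_equivalent_elementary_collapse:
  assumes K: "finite_complex K" and \<sigma>: "finite \<sigma>" "\<sigma> \<noteq> {}" and w: "w \<notin> \<sigma>"
    and apex: "\<And>\<tau>. \<tau> \<in> K \<Longrightarrow> \<sigma> \<subseteq> \<tau> \<Longrightarrow> insert w \<tau> \<in> K"
  shows "geom_realization K homotopy_equivalent_space geom_realization {\<tau>\<in>K. \<not> \<sigma> \<subseteq> \<tau>}"
proof -
  let ?L = "{\<tau>\<in>K. \<not> \<sigma> \<subseteq> \<tau>}"
  have down: "\<And>S T. S \<in> K \<Longrightarrow> T \<subseteq> S \<Longrightarrow> T \<in> K" and finK: "finite (\<Union>K)"
    using K by (auto simp: finite_complex_def)
  define A where "A = insert w (\<sigma> \<union> \<Union>K)"
  have A: "finite A" "\<Union>K \<subseteq> A" "\<Union>?L \<subseteq> A" "\<sigma> \<subseteq> A" "w \<in> A"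
    using finK \<sigma> by (auto simp: A_def)
  define m :: "('a \<Rightarrow> real) \<Rightarrow> real" where "m x = Min (x ` \<sigma>)" for x
  define f where "f x = (\<lambda>v. x v - (if v \<in> \<sigma> then m x else 0) + (if v = w then real (card \<sigma>) * m x else 0))" for x
  have m_le: "m x \<le> x v" if "v \<in> \<sigma>" for x v
    using \<sigma> that by (simp add: m_def)
  have m_attained: "\<exists>v\<in>\<sigma>. x v = m x" for x
  proof -
    have "m x \<in> x ` \<sigma>"
      unfolding m_def by (rule Min_in) (use \<sigma> in auto)
    then show ?thesis
      by (metis imageE)
  qed
  have m_pos: "m x > 0 \<longleftrightarrow> \<sigma> \<subseteq> supp x" "m x \<ge> 0" if "\<And>v. 0 \<le> x v" for x
  proof -
    show "m x \<ge> 0"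
      using m_attained[of x] that by metis
    show "m x > 0 \<longleftrightarrow> \<sigma> \<subseteq> supp x"
    proof
      assume "m x > 0"
      then have "x v \<noteq> 0" if "v \<in> \<sigma>" for v
        using m_le[OF that, of x] by linarith
      then show "\<sigma> \<subseteq> supp x"
        by blast
    next
      obtain v where v: "v \<in> \<sigma>" "x v = m x"
        using m_attained by blast
      assume "\<sigma> \<subseteq> supp x"
      then have "x v \<noteq> 0"
        using v by blast
      then show "m x > 0"
        using v(2) that[of v] by linarith
    qed
  qed
  have f_eq: "f x = x" if "\<And>v. 0 \<le> x v" "\<not> \<sigma> \<subseteq> supp x" for x
    using m_pos[of x] that by (auto simp: f_def fun_eq_iff)
  have sum_f: "sum (f x) A = sum x A" for x
  proof -
    have "sum (f x) A = sum x A - (\<Sum>v\<in>A. if v \<in> \<sigma> then m x else 0) + (\<Sum>v\<in>A. if v = w then real (card \<sigma>) * m x else 0)"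
      by (simp add: f_def sum.distrib sum_subtractf)
    moreover have "(\<Sum>v\<in>A. if v \<in> \<sigma> then m x else 0) = real (card \<sigma>) * m x"
      using A by (simp add: sum.If_cases Int_absorb1)
    ultimately show ?thesis
      using A by simp
  qed
  have f_nonneg: "0 \<le> f x v" if "\<And>v. 0 \<le> x v" for x v
    using m_le[of v x] m_pos[OF that] that[of v] w by (auto simp: f_def)
  have supp_f: "supp (f x) \<in> ?L \<and> supp x \<union> supp (f x) \<in> K" if "supp x \<in> K" "\<And>v. 0 \<le> x v" for x
  proof (cases "\<sigma> \<subseteq> supp x")
    case True
    obtain v where v: "v \<in> \<sigma>" "x v = m x"
      using m_attained by blast
    then have "f x v = 0"
      using w by (auto simp: f_def)
    then have "\<not> \<sigma> \<subseteq> supp (f x)"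
      using v by auto
    moreover have "supp (f x) \<subseteq> insert w (supp x)"
      using True by (auto simp: f_def split: if_splits)
    then have "supp x \<union> supp (f x) \<subseteq> insert w (supp x)"
      by auto
    ultimately show ?thesis
      using apex[OF that(1) True] down by (metis (mono_tags, lifting) Un_upper2 mem_Collect_eq)
  next
    case False
    then show ?thesis
      using f_eq[of x] that by auto
  qed
  have f_cont: "continuous_map (geom_realization K) (geom_realization ?L) f"
    unfolding continuous_map_into_geom_realization
  proof (intro conjI allI ballI)
    fix v
    show "continuous_map (geom_realization K) euclideanreal (\<lambda>x. f x v)"
      unfolding f_def m_def using \<sigma>
      by (cases "v \<in> \<sigma>"; cases "v = w") (auto intro!: continuous_intros continuous_map_real_Min
          continuous_map_geom_realization_coordinate)
  next
    fix x assume "x \<in> topspace (geom_realization K)"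
    then show "f x \<in> topspace (geom_realization ?L)"
      unfolding in_geom_realization_iff[OF A(1,2)] in_geom_realization_iff[OF A(1,3)]
      using supp_f f_nonneg sum_f by auto
  qed
  have incl: "continuous_map (geom_realization ?L) (geom_realization K) id"
    unfolding continuous_map_into_geom_realization
    by (auto simp: continuous_map_geom_realization_coordinate topspace_geom_realization)
  have "homotopic_with (\<lambda>_. True) (geom_realization K) (geom_realization K) (id \<circ> f) id"
  proof (rule homotopic_straight_line_geom_realization[OF K])
    show "continuous_map (geom_realization K) (geom_realization K) (id \<circ> f)"
      using continuous_map_compose[OF f_cont incl] .
    show "supp ((id \<circ> f) x) \<union> supp (id x) \<in> K" if "x \<in> topspace (geom_realization K)" for x
      using supp_f[of x] that by (simp add: topspace_geom_realization Un_commute)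
  qed auto
  moreover have "homotopic_with (\<lambda>_. True) (geom_realization ?L) (geom_realization ?L) (f \<circ> id) id"
    using continuous_map_compose[OF incl f_cont]
    by (intro homotopic_with_equal) (auto simp: topspace_geom_realization intro!: f_eq)
  ultimately show ?thesis
    unfolding homotopy_equivalent_space_def using f_cont incl by blast
qed

lemma homotopy_equivalent_image_complex:
  assumes K: "finite_complex K" and inj: "inj_on f (\<Union>K)"
  shows "geom_realization K homotopy_equivalent_space geom_realization ((`) f ` K)"
proof -
  let ?V = "\<Union>K" and ?K' = "(`) f ` K"
  have fin: "finite ?V" "finite (f ` ?V)" and un: "\<Union>?K' = f ` ?V"
    using K by (auto simp: finite_complex_def)
  \<comment> \<open>Both maps are extended by 0 off the vertex sets; they are mutually inverse
    because points of a realization vanish there.\<close>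
  define F where "F = (\<lambda>(x::'a \<Rightarrow> real) v. if v \<in> f ` ?V then x (inv_into ?V f v) else 0)"
  define G where "G = (\<lambda>(y::'b \<Rightarrow> real) v. if v \<in> ?V then y (f v) else 0)"
  have supp_F: "supp (F x) = f ` supp x" if "supp x \<in> K" for x
  proof -
    have "supp x \<subseteq> ?V" using that by auto
    have Ff: "F x (f v) = x v" if "v \<in> ?V" for v
      using inj that by (simp add: F_def)
    show ?thesis
    proof (intro equalityI subsetI)
      fix u assume u: "u \<in> supp (F x)"
      then have "u \<in> f ` ?V"
        unfolding F_def by (metis (mono_tags, lifting) mem_Collect_eq)
      then obtain v where "v \<in> ?V" "u = f v" by blast
      with u Ff show "u \<in> f ` supp x" by simp
    next
      fix u assume "u \<in> f ` supp x"
      then obtain v where v: "v \<in> supp x" "u = f v" by blast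
      then have "v \<in> ?V"
        using \<open>supp x \<subseteq> ?V\<close> by blast
      with v Ff show "u \<in> supp (F x)" by simp
    qed
  qed
  have F_in: "F x \<in> topspace (geom_realization ?K')" if "x \<in> topspace (geom_realization K)" for x
  proof -
    have "sum (F x) (f ` ?V) = sum x ?V"
      using inj by (subst sum.reindex) (auto simp: F_def intro!: sum.cong)
    then show ?thesis
      using that supp_F[of x] in_geom_realization_iff[OF fin(1) order_refl, of x]
      by (subst in_geom_realization_iff[OF fin(2)]) (auto simp: un F_def)
  qed
  have supp_G: "supp (G y) \<in> K \<and> f ` supp (G y) = supp y" if "supp y \<in> ?K'" for y
  proof -
    from that obtain S where S: "S \<in> K" "supp y = f ` S" by blast
    then have "S \<subseteq> ?V" by blast
    have "v \<in> supp (G y) \<longleftrightarrow> v \<in> S" for v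
    proof -
      have "v \<in> supp (G y) \<longleftrightarrow> v \<in> ?V \<and> f v \<in> supp y"
        by (simp add: G_def)
      then show ?thesis
        unfolding S(2) using inj_on_image_mem_iff[OF inj, of v S] \<open>S \<subseteq> ?V\<close> by blast
    qed
    then have "supp (G y) = S" by blast
    then show ?thesis using S by auto
  qed
  have G_in: "G y \<in> topspace (geom_realization K)" if "y \<in> topspace (geom_realization ?K')" for y
  proof -
    have "sum (G y) ?V = sum y (f ` ?V)"
      using inj by (subst sum.reindex) (auto simp: G_def intro!: sum.cong)
    then show ?thesis
      using that supp_G[of y] in_geom_realization_iff[OF fin(2), of ?K' y]
      by (subst in_geom_realization_iff[OF fin(1)]) (auto simp: un G_def)
  qed
  have "homeomorphic_maps (geom_realization K) (geom_realization ?K') F G"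
    unfolding homeomorphic_maps_def continuous_map_into_geom_realization
  proof (intro conjI allI ballI F_in G_in)
    show "continuous_map (geom_realization K) euclideanreal (\<lambda>x. F x v)" for v
      by (cases "v \<in> f ` ?V") (simp_all add: F_def continuous_map_geom_realization_coordinate)
    show "continuous_map (geom_realization ?K') euclideanreal (\<lambda>x. G x v)" for v
      by (cases "v \<in> ?V") (simp_all add: G_def continuous_map_geom_realization_coordinate)
    fix x assume x: "x \<in> topspace (geom_realization K)"
    have "x v = 0" if "v \<notin> ?V" for v
      using geom_realization_eq_0[OF x that] .
    then show "G (F x) = x"
      using inj by (auto simp: F_def G_def fun_eq_iff)
  next
    fix y assume y: "y \<in> topspace (geom_realization ?K')"
    have "y v = 0" if "v \<notin> f ` ?V" for v
      using geom_realization_eq_0[OF y] that un by simp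
    moreover have "F (G y) (f v) = y (f v)" if "v \<in> ?V" for v
      using inj that by (simp add: F_def G_def)
    moreover have "F (G y) u = 0" if "u \<notin> f ` ?V" for u
      using that by (simp add: F_def)
    ultimately show "F (G y) = y"
      by (metis ext imageE)
  qed
  then show ?thesis
    using homeomorphic_imp_homotopy_equivalent_space homeomorphic_space_def by blast
qed

subsection \<open>Collapses and suspensions\<close>

text \<open>Closure under symmetry admits expansions as well as collapses: the crossing at a vertex
  first removes simplices, then adds others, and then removes again.\<close>

inductive collapse_equiv :: "'a set set \<Rightarrow> 'a set set \<Rightarrow> bool" where
  collapse_refl: "finite_complex K \<Longrightarrow> collapse_equiv K K"
| collapse_step: "\<lbrakk>finite_complex K; finite \<sigma>; \<sigma> \<noteq> {}; w \<notin> \<sigma>; \<And>\<tau>. \<tau> \<in> K \<Longrightarrow> \<sigma> \<subseteq> \<tau> \<Longrightarrow> insert w \<tau> \<in> K\<rbrakk>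
    \<Longrightarrow> collapse_equiv K {\<tau>\<in>K. \<not> \<sigma> \<subseteq> \<tau>}"
| collapse_sym: "collapse_equiv K L \<Longrightarrow> collapse_equiv L K"
| collapse_trans: "\<lbrakk>collapse_equiv K L; collapse_equiv L M\<rbrakk> \<Longrightarrow> collapse_equiv K M"

lemma collapse_equiv_imp_homotopy_equivalent:
  assumes "collapse_equiv K L"
  shows "geom_realization K homotopy_equivalent_space geom_realization L"
  using assms
proof (induction rule: collapse_equiv.induct)
  case (collapse_step K \<sigma> w)
  then show ?case by (rule homotopy_equivalent_elementary_collapse)
next
  case (collapse_trans K L M)
  then show ?case using homotopy_eqv_trans by blast
next
  case (collapse_sym K L)
  then show ?case using homotopy_equivalent_space_sym by blast
qed (rule homotopy_equivalent_space_refl)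

lemma finite_complex_filter:
  assumes "finite_complex K"
  shows "finite_complex {\<tau>\<in>K. \<forall>\<sigma>\<in>\<Sigma>. \<not> \<sigma> \<subseteq> \<tau>}"
proof -
  have "\<Union>{\<tau>\<in>K. \<forall>\<sigma>\<in>\<Sigma>. \<not> \<sigma> \<subseteq> \<tau>} \<subseteq> \<Union>K" by blast
  then have "finite (\<Union>{\<tau>\<in>K. \<forall>\<sigma>\<in>\<Sigma>. \<not> \<sigma> \<subseteq> \<tau>})"
    by (rule finite_subset) (use assms in \<open>simp add: finite_complex_def\<close>)
  moreover have "T \<in> {\<tau>\<in>K. \<forall>\<sigma>\<in>\<Sigma>. \<not> \<sigma> \<subseteq> \<tau>}" if "S \<in> {\<tau>\<in>K. \<forall>\<sigma>\<in>\<Sigma>. \<not> \<sigma> \<subseteq> \<tau>}" "T \<subseteq> S" for S T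
    using assms that unfolding finite_complex_def by blast
  ultimately show ?thesis
    unfolding finite_complex_def by blast
qed

text \<open>
  The last hypothesis makes the removal of the simplices of \<open>\<Sigma>\<close> order-independent: inserting the
  apex never completes another member of \<open>\<Sigma>\<close>.
\<close>

lemma collapse_equiv_family:
  assumes K: "finite_complex K" and "\<Union>\<Sigma> \<subseteq> \<Union>K" and "{} \<notin> \<Sigma>"
    and L: "L = {\<tau>\<in>K. \<forall>\<sigma>\<in>\<Sigma>. \<not> \<sigma> \<subseteq> \<tau>}"
    and apex: "\<And>\<sigma>. \<sigma> \<in> \<Sigma> \<Longrightarrow> \<exists>w. w \<notin> \<sigma> \<and> (\<forall>\<tau>\<in>K. \<sigma> \<subseteq> \<tau> \<longrightarrow> insert w \<tau> \<in> K \<and>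
        (\<forall>\<sigma>'\<in>\<Sigma>. \<sigma>' \<subseteq> insert w \<tau> \<longrightarrow> \<sigma>' \<subseteq> \<tau>))"
  shows "collapse_equiv K L"
proof -
  have finU: "finite (\<Union>K)"
    using K by (simp add: finite_complex_def)
  have "finite \<Sigma>"
    using finite_subset[OF assms(2) finU] by (rule finite_UnionD)
  moreover have "collapse_equiv K {\<tau>\<in>K. \<forall>\<sigma>\<in>\<Phi>. \<not> \<sigma> \<subseteq> \<tau>}" if "finite \<Phi>" "\<Phi> \<subseteq> \<Sigma>" for \<Phi>
    using that
  proof (induction \<Phi> rule: finite_induct)
    case empty
    then show ?case using collapse_refl[OF K] by simp
  next
    case (insert \<sigma> \<Phi>)
    let ?M = "{\<tau>\<in>K. \<forall>\<sigma>\<in>\<Phi>. \<not> \<sigma> \<subseteq> \<tau>}"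
    have "\<sigma> \<in> \<Sigma>" using insert by blast
    then obtain w where w: "w \<notin> \<sigma>" "\<And>\<tau>. \<tau> \<in> K \<Longrightarrow> \<sigma> \<subseteq> \<tau> \<Longrightarrow> insert w \<tau> \<in> K"
      "\<And>\<tau> \<sigma>'. \<tau> \<in> K \<Longrightarrow> \<sigma> \<subseteq> \<tau> \<Longrightarrow> \<sigma>' \<in> \<Sigma> \<Longrightarrow> \<sigma>' \<subseteq> insert w \<tau> \<Longrightarrow> \<sigma>' \<subseteq> \<tau>"
      using apex by metis
    have "collapse_equiv ?M {\<tau>\<in>?M. \<not> \<sigma> \<subseteq> \<tau>}"
    proof (rule collapse_step)
      show "finite_complex ?M" using K by (rule finite_complex_filter)
      show "finite \<sigma>" using \<open>\<sigma> \<in> \<Sigma>\<close> assms(2) finU by (meson Union_upper finite_subset order_trans)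
      show "\<sigma> \<noteq> {}" using \<open>\<sigma> \<in> \<Sigma>\<close> assms(3) by blast
      show "w \<notin> \<sigma>" by (rule w(1))
      show "insert w \<tau> \<in> ?M" if "\<tau> \<in> ?M" "\<sigma> \<subseteq> \<tau>" for \<tau>
      proof -
        have "\<tau> \<in> K" "\<forall>\<sigma>\<in>\<Phi>. \<not> \<sigma> \<subseteq> \<tau>"
          using that(1) by auto
        moreover have "\<sigma>' \<in> \<Sigma>" if "\<sigma>' \<in> \<Phi>" for \<sigma>'
          using insert.prems that by blast
        ultimately show ?thesis
          using w(2)[OF _ that(2)] w(3)[OF _ that(2)] by simp meson
      qed
    qed
    moreover have "{\<tau>\<in>?M. \<not> \<sigma> \<subseteq> \<tau>} = {\<tau>\<in>K. \<forall>\<sigma>\<in>insert \<sigma> \<Phi>. \<not> \<sigma> \<subseteq> \<tau>}" by blast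
    ultimately show ?case
      using insert collapse_trans by auto
  qed
  ultimately show ?thesis
    using L by blast
qed

text \<open>\<open>(True, j)\<close> and \<open>(False, j)\<close> are the two opposite vertices on
  the \<open>j\<close>-th axis. For \<open>m = 0\<close> only the empty simplex is left, so
  \<open>suspend 0\<close> is a mere relabelling.\<close>

definition cross_polytope :: "nat \<Rightarrow> (bool \<times> nat) set set" where
  "cross_polytope m = {T. T \<subseteq> UNIV \<times> {..<m} \<and> (\<forall>j. (True, j) \<notin> T \<or> (False, j) \<notin> T)}"

text \<open>The join with the boundary of the \<open>m\<close>-dimensional cross-polytope, that is, an \<open>m\<close>-fold suspension.\<close>

definition suspend :: "nat \<Rightarrow> 'a set set \<Rightarrow> ('a + bool \<times> nat) set set" where
  "suspend m K = {\<tau>. Inl -` \<tau> \<in> K \<and> Inr -` \<tau> \<in> cross_polytope m}"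

lemma finite_complex_suspend:
  assumes "finite_complex K"
  shows "finite_complex (suspend m K)"
proof -
  have "\<Union>(suspend m K) \<subseteq> Inl ` \<Union>K \<union> Inr ` (UNIV \<times> {..<m})"
  proof
    fix x assume "x \<in> \<Union>(suspend m K)"
    then obtain \<tau> where "x \<in> \<tau>" "Inl -` \<tau> \<in> K" "Inr -` \<tau> \<subseteq> UNIV \<times> {..<m}"
      by (auto simp: suspend_def cross_polytope_def)
    then show "x \<in> Inl ` \<Union>K \<union> Inr ` (UNIV \<times> {..<m})"
      by (cases x) auto
  qed
  then have "finite (\<Union>(suspend m K))"
    by (rule finite_subset) (use assms in \<open>simp add: finite_complex_def\<close>)
  moreover have "T \<in> suspend m K" if "S \<in> suspend m K" "T \<subseteq> S" for S T
  proof -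
    have "Inl -` T \<subseteq> Inl -` S" "Inr -` T \<subseteq> Inr -` S" using that by auto
    with that assms show ?thesis
      unfolding suspend_def cross_polytope_def finite_complex_def
      by (intro CollectI conjI) (blast, blast, blast)
  qed
  ultimately show ?thesis
    by (auto simp: finite_complex_def)
qed

text \<open>The star of the copy of \<open>\<sigma>\<close> in a join is the join of the star of
  \<open>\<sigma>\<close> with the other factor, hence again a cone with the same apex.\<close>

lemma collapse_equiv_suspend:
  assumes "collapse_equiv K L"
  shows "collapse_equiv (suspend m K) (suspend m L)"
  using assms
proof (induction rule: collapse_equiv.induct)
  case (collapse_step K \<sigma> w)
  have "collapse_equiv (suspend m K) {\<tau>\<in>suspend m K. \<not> Inl ` \<sigma> \<subseteq> \<tau>}"
  proof (rule collapse_equiv.collapse_step)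
    show "insert (Inl w) \<tau> \<in> suspend m K" if "\<tau> \<in> suspend m K" "Inl ` \<sigma> \<subseteq> \<tau>" for \<tau>
    proof -
      have "Inl -` insert (Inl w) \<tau> = insert w (Inl -` \<tau>)" "Inr -` insert (Inl w) \<tau> = Inr -` \<tau>"
        by auto
      moreover have "\<sigma> \<subseteq> Inl -` \<tau>"
        using that by auto
      ultimately show ?thesis
        using that collapse_step by (simp add: suspend_def)
    qed
  qed (use collapse_step in \<open>auto simp: finite_complex_suspend\<close>)
  moreover have "{\<tau>\<in>suspend m K. \<not> Inl ` \<sigma> \<subseteq> \<tau>} = suspend m {\<tau>\<in>K. \<not> \<sigma> \<subseteq> \<tau>}"
    by (auto simp: suspend_def)
  ultimately show ?case by simp
qed (auto intro: collapse_equiv.intros finite_complex_suspend)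

lemma homotopy_equivalent_suspend_0:
  assumes "finite_complex K"
  shows "geom_realization K homotopy_equivalent_space geom_realization (suspend 0 K)"
proof -
  have "(`) Inl ` K = suspend 0 K"
  proof (intro equalityI subsetI)
    fix \<tau> :: "('a + bool \<times> nat) set" assume "\<tau> \<in> suspend 0 K"
    then have "Inl -` \<tau> \<in> K" "Inr -` \<tau> = {}"
      by (auto simp: suspend_def cross_polytope_def)
    moreover from this have "\<tau> = Inl ` (Inl -` \<tau>)"
      by (auto simp: image_iff) (metis sum.exhaust vimage_eq empty_iff)
    ultimately show "\<tau> \<in> (`) Inl ` K" by blast
  qed (auto simp: suspend_def cross_polytope_def vimage_def image_iff)
  then show ?thesis
    using homotopy_equivalent_image_complex[OF assms, of "Inl :: 'a \<Rightarrow> 'a + bool \<times> nat"] by (simp add: inj_on_def)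
qed

text \<open>\<open>w\<close> and \<open>b\<close> are suspension points over \<open>D\<close>; they
  become the next antipodal pair, with index \<open>m\<close>. The relabelling \<open>\<phi>\<close>
  of the base is done in the same move, since \<open>f\<close> renames all vertices at once and the
  base may change its vertex type.\<close>

lemma homotopy_equivalent_suspend_Suc:
  assumes D: "finite_complex D" and inj: "inj_on \<phi> (\<Union>D)" and wb: "w \<noteq> b" "w \<notin> \<Union>D" "b \<notin> \<Union>D"
  shows "geom_realization (suspend m {S \<union> W |S W. S \<in> D \<and> W \<in> {{}, {w}, {b}}})
    homotopy_equivalent_space geom_realization (suspend (Suc m) ((`) \<phi> ` D))"
proof -
  let ?E = "{S \<union> W |S W. S \<in> D \<and> W \<in> {{}, {w}, {b}}}"
  define f where "f = case_sum (\<lambda>v. if v = w then Inr (True, m) else if v = b then Inr (False, m) else Inl (\<phi> v)) Inr"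
  have E: "finite_complex ?E"
  proof -
    have "\<Union>?E \<subseteq> {w, b} \<union> \<Union>D" by auto
    then have "finite (\<Union>?E)"
      by (rule finite_subset) (use D in \<open>simp add: finite_complex_def\<close>)
    moreover have "T \<in> ?E" if "S \<in> D" "W \<in> {{}, {w}, {b}}" "T \<subseteq> S \<union> W" for S W T
    proof -
      have "T \<inter> S \<in> D" using D that by (auto simp: finite_complex_def)
      moreover have "T \<inter> W \<in> {{}, {w}, {b}}" using that by auto
      moreover have "T = (T \<inter> S) \<union> (T \<inter> W)" using that by auto
      ultimately show ?thesis by blast
    qed
    ultimately show ?thesis
      unfolding finite_complex_def by blast
  qed
  have in_E: "S \<subseteq> insert w (insert b (\<Union>D))" if "S \<in> ?E" for S
    using that by auto
  have inl_inr: "\<tau> = Inl ` (Inl -` \<tau>) \<union> Inr ` (Inr -` \<tau>)" for \<tau> :: "('x + 'y) set"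
  proof (intro equalityI subsetI)
    fix x assume "x \<in> \<tau>"
    then show "x \<in> Inl ` (Inl -` \<tau>) \<union> Inr ` (Inr -` \<tau>)" by (cases x) auto
  qed auto
  have f_image: "f ` \<tau> = Inl ` \<phi> ` S \<union> Inr ` (T \<union> (if w \<in> W then {(True, m)} else {}) \<union> (if b \<in> W then {(False, m)} else {}))"
    if "Inl -` \<tau> = S \<union> W" "Inr -` \<tau> = T" "S \<in> D" "W \<in> {{}, {w}, {b}}" for \<tau> S W T
  proof -
    have "\<tau> = Inl ` S \<union> Inl ` W \<union> Inr ` T"
      using inl_inr[of \<tau>] that(1,2) by (simp add: image_Un)
    moreover have "f ` Inl ` S = Inl ` \<phi> ` S"
      using that(3) wb unfolding image_image by (intro image_cong) (auto simp: f_def)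
    moreover have "f ` Inl ` W = Inr ` ((if w \<in> W then {(True, m)} else {}) \<union> (if b \<in> W then {(False, m)} else {}))"
      using that(4) wb by (auto simp: f_def)
    moreover have "f ` Inr ` T = Inr ` T"
      by (simp add: f_def image_image)
    ultimately show ?thesis
      by (simp only: image_Un Un_assoc Un_left_commute Un_commute)
  qed
  have "(`) f ` suspend m ?E = suspend (Suc m) ((`) \<phi> ` D)"
  proof (intro equalityI subsetI)
    fix \<tau>' assume "\<tau>' \<in> (`) f ` suspend m ?E"
    then obtain \<tau> S W where \<tau>: "\<tau>' = f ` \<tau>" "Inl -` \<tau> = S \<union> W" "S \<in> D" "W \<in> {{}, {w}, {b}}"
      and T: "Inr -` \<tau> \<in> cross_polytope m"
      unfolding suspend_def by blast
    have "Inl -` \<tau>' = \<phi> ` S"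
      unfolding \<tau>(1) f_image[OF \<tau>(2) refl \<tau>(3,4)] by auto
    moreover have "Inr -` \<tau>' \<in> cross_polytope (Suc m)"
      unfolding \<tau>(1) f_image[OF \<tau>(2) refl \<tau>(3,4)] using T \<tau>(4) wb(1)
      by (auto simp: cross_polytope_def)
    ultimately show "\<tau>' \<in> suspend (Suc m) ((`) \<phi> ` D)"
      using \<tau>(3) by (auto simp: suspend_def)
  next
    fix \<tau>' assume "\<tau>' \<in> suspend (Suc m) ((`) \<phi> ` D)"
    then obtain S where S: "Inl -` \<tau>' = \<phi> ` S" "S \<in> D" and T': "Inr -` \<tau>' \<in> cross_polytope (Suc m)"
      by (auto simp: suspend_def)
    define W where "W = (if (True, m) \<in> Inr -` \<tau>' then {w} else {}) \<union> (if (False, m) \<in> Inr -` \<tau>' then {b} else {})"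
    define T where "T = Inr -` \<tau>' \<inter> UNIV \<times> {..<m}"
    define \<tau> where "\<tau> = Inl ` (S \<union> W) \<union> Inr ` T"
    have W: "W \<in> {{}, {w}, {b}}"
      using T' by (auto simp: W_def cross_polytope_def)
    have \<tau>: "Inl -` \<tau> = S \<union> W" "Inr -` \<tau> = T"
      by (auto simp: \<tau>_def)
    have R: "Inr -` \<tau>' \<subseteq> UNIV \<times> {..<m} \<union> {(True, m), (False, m)}"
      using T' by (auto simp: cross_polytope_def less_Suc_eq)
    have "w \<in> W \<longleftrightarrow> (True, m) \<in> Inr -` \<tau>'" "b \<in> W \<longleftrightarrow> (False, m) \<in> Inr -` \<tau>'"
      using wb(1) by (auto simp: W_def)
    then have "T \<union> (if w \<in> W then {(True, m)} else {}) \<union> (if b \<in> W then {(False, m)} else {}) = Inr -` \<tau>'"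
      unfolding T_def using R by (simp only:) auto
    then have "f ` \<tau> = \<tau>'"
      using f_image[OF \<tau> S(2) W] S(1) inl_inr[of \<tau>'] by simp
    moreover have "\<tau> \<in> suspend m ?E"
    proof -
      have "T \<in> cross_polytope m"
        using T' by (auto simp: T_def cross_polytope_def)
      moreover have "S \<union> W \<in> ?E"
        using S(2) W by blast
      ultimately show ?thesis
        by (simp only: suspend_def mem_Collect_eq \<tau>)
    qed
    ultimately show "\<tau>' \<in> (`) f ` suspend m ?E" by blast
  qed
  moreover have "inj_on f (\<Union>(suspend m ?E))"
  proof (rule inj_on_subset)
    show "inj_on f (Inl ` (insert w (insert b (\<Union>D))) \<union> Inr ` (UNIV \<times> {..<m}))"
    proof -
      define U where "U = \<Union>D"
      have "inj_on \<phi> U" "w \<notin> U" "b \<notin> U"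
        using inj wb by (simp_all add: U_def)
      then show ?thesis
        using wb(1) unfolding U_def[symmetric]
        by (intro inj_onI) (auto simp: f_def split: if_splits dest: inj_onD)
    qed
    show "\<Union>(suspend m ?E) \<subseteq> Inl ` (insert w (insert b (\<Union>D))) \<union> Inr ` (UNIV \<times> {..<m})"
    proof
      fix x assume "x \<in> \<Union>(suspend m ?E)"
      then obtain \<tau> where "x \<in> \<tau>" "\<tau> \<in> suspend m ?E"
        by (rule UnionE)
      then have \<tau>: "x \<in> \<tau>" "Inl -` \<tau> \<in> ?E" "Inr -` \<tau> \<subseteq> UNIV \<times> {..<m}"
        by (simp_all only: suspend_def cross_polytope_def mem_Collect_eq)
      show "x \<in> Inl ` (insert w (insert b (\<Union>D))) \<union> Inr ` (UNIV \<times> {..<m})"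
      proof (cases x)
        case (Inl a)
        then have "a \<in> Inl -` \<tau>"
          using \<tau>(1) by simp
        then have "a \<in> insert w (insert b (\<Union>D))"
          using in_E[OF \<tau>(2)] by (rule rev_subsetD)
        then show ?thesis
          unfolding Inl by (intro UnI1 imageI)
      next
        case (Inr a)
        then have "a \<in> Inr -` \<tau>"
          using \<tau>(1) by simp
        then have "a \<in> UNIV \<times> {..<m}"
          using \<tau>(3) by (rule rev_subsetD)
        then show ?thesis
          unfolding Inr by (intro UnI2 imageI)
      qed
    qed
  qed
  ultimately show ?thesis
    using homotopy_equivalent_image_complex[OF finite_complex_suspend[OF E, of m], of f] by simp
qed

subsection \<open>Crossing at a vertex\<close>

lemma finite_complex_independence_complex:
  assumes "finite V"
  shows "finite_complex (independence_complex V E)"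
proof -
  have "\<Union>(independence_complex V E) \<subseteq> V"
    by (auto simp: independence_complex_def)
  then have "finite (\<Union>(independence_complex V E))"
    using assms by (rule finite_subset)
  moreover have "T \<in> independence_complex V E" if "S \<in> independence_complex V E" "T \<subseteq> S" for S T
    using that finite_subset[OF that(2)] unfolding independence_complex_def by auto
  ultimately show ?thesis
    by (simp add: finite_complex_def)
qed

text \<open>Simplices are sorted by their part \<open>S\<close> in \<open>U\<close>, where
  \<open>Bc S\<close> is the set of common non-neighbours of \<open>S\<close> in \<open>B\<close>.
  If \<open>Bc S\<close> is empty, then \<open>w\<close> can be added, and these simplices collapse
  away. Over the remaining \<open>S\<close>, the part in \<open>B\<close> is confined to the
  nonempty face \<open>Bc S\<close> of the full simplex on \<open>B\<close>; expansions replace this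
  face by the full simplex, which then contracts to \<open>b0\<close>. What remains over
  \<open>D\<close> are the two points \<open>w\<close> and \<open>b0\<close>.\<close>

lemma collapse_equiv_crossing:
  assumes fin: "finite V" and w: "w \<in> V" "\<not> E w w" and B: "B = {v\<in>V. E w v}"
    and sym: "\<And>u v. u \<in> V \<Longrightarrow> v \<in> V \<Longrightarrow> E u v \<Longrightarrow> E v u"
    and indep: "\<And>u v. u \<in> B \<Longrightarrow> v \<in> B \<Longrightarrow> \<not> E u v"
    and b0: "b0 \<in> B"
    and D: "D = {S\<in>independence_complex (V - insert w B) E. \<exists>b\<in>B. \<forall>u\<in>S. \<not> E u b}"
  shows "collapse_equiv (independence_complex V E) {S \<union> W |S W. S \<in> D \<and> W \<in> {{}, {w}, {b0}}}"
proof -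
  define U where "U = V - insert w B"
  define Bc where "Bc S = {b\<in>B. \<forall>u\<in>S. \<not> E u b}" for S
  define I where "I = independence_complex U E"
  define K0 where "K0 = {\<tau>. \<tau> \<subseteq> V \<and> \<tau> \<inter> U \<in> I \<and> (w \<in> \<tau> \<longrightarrow> \<tau> \<inter> B = {}) \<and> \<tau> \<inter> B \<subseteq> Bc (\<tau> \<inter> U)}"
  \<comment> \<open>\<open>L c\<close> relaxes the condition on the part in \<open>B\<close> for
    simplices with fewer than \<open>c\<close> vertices in \<open>U\<close>: \<open>L 0\<close>
    imposes it always, \<open>L (Suc (card V))\<close> never.\<close>
  define L where "L c = {\<tau>. \<tau> \<subseteq> V \<and> \<tau> \<inter> U \<in> D \<and> (w \<in> \<tau> \<longrightarrow> \<tau> \<inter> B = {}) \<and>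
    (c \<le> card (\<tau> \<inter> U) \<longrightarrow> \<tau> \<inter> B \<subseteq> Bc (\<tau> \<inter> U))}" for c
  define M where "M = {\<tau>. \<tau> \<subseteq> V \<and> \<tau> \<inter> U \<in> D \<and> (w \<in> \<tau> \<longrightarrow> \<tau> \<inter> B = {}) \<and> \<tau> \<inter> B \<subseteq> {b0}}"
  have part: "U \<subseteq> V" "B \<subseteq> V" "U \<inter> B = {}" "w \<notin> U" "w \<notin> B" "V = insert w (U \<union> B)"
    using B w by (auto simp: U_def)
  have D_iff: "S \<in> D \<longleftrightarrow> S \<in> I \<and> Bc S \<noteq> {}" for S
    by (auto simp: D I_def U_def Bc_def)
  have I_sub: "S \<subseteq> U" if "S \<in> I" for S
    using that by (simp add: I_def independence_complex_def)
  have I_down: "T \<in> I" if "S \<in> I" "T \<subseteq> S" for S T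
    using that finite_complex_independence_complex[of U E] finite_subset[OF part(1) fin]
    by (auto simp: I_def finite_complex_def)
  have Bc_anti: "Bc S \<subseteq> Bc T" if "T \<subseteq> S" for S T
    using that by (auto simp: Bc_def)
  have Bc_sub: "Bc S \<subseteq> B" for S
    by (auto simp: Bc_def)
  have D_down: "T \<in> D" if "S \<in> D" "T \<subseteq> S" for S T
    using that I_down Bc_anti[OF that(2)] D_iff by auto
  have fin_V: "finite S" if "S \<subseteq> V" for S
    using that fin by (rule finite_subset)

  have K0: "independence_complex V E = K0"
  proof (intro set_eqI iffI)
    fix \<tau> assume "\<tau> \<in> independence_complex V E"
    then have *: "\<tau> \<subseteq> V" "\<And>u v. u \<in> \<tau> \<Longrightarrow> v \<in> \<tau> \<Longrightarrow> \<not> E u v"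
      by (auto simp: independence_complex_def)
    have "\<tau> \<inter> U \<in> I"
      using fin_V[OF *(1)] *(2) by (simp add: I_def independence_complex_def)
    moreover have "\<tau> \<inter> B = {}" if "w \<in> \<tau>"
      using *(2)[OF that] B by blast
    moreover have "\<tau> \<inter> B \<subseteq> Bc (\<tau> \<inter> U)"
      using *(2) by (auto simp: Bc_def)
    ultimately show "\<tau> \<in> K0"
      using *(1) by (simp add: K0_def)
  next
    fix \<tau> assume "\<tau> \<in> K0"
    then have *: "\<tau> \<subseteq> V" "\<tau> \<inter> U \<in> I" "w \<in> \<tau> \<Longrightarrow> \<tau> \<inter> B = {}" "\<tau> \<inter> B \<subseteq> Bc (\<tau> \<inter> U)"
      by (auto simp: K0_def)
    have "\<not> E u v" if "u \<in> \<tau>" "v \<in> \<tau>" for u v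
    proof
      assume E: "E u v"
      have V: "u \<in> V" "v \<in> V" using that * by auto
      have E': "E v u" using sym[OF V E] .
      have "u = w \<or> u \<in> U \<or> u \<in> B" "v = w \<or> v \<in> U \<or> v \<in> B"
        using V part by auto
      moreover have "u \<noteq> w"
      proof
        assume "u = w"
        then have "v \<in> B" using E V B by simp
        then show False using *(3) \<open>u = w\<close> that by auto
      qed
      moreover have "v \<noteq> w"
      proof
        assume "v = w"
        then have "u \<in> B" using E' V B by simp
        then show False using *(3) \<open>v = w\<close> that by auto
      qed
      moreover have "\<not> (u \<in> U \<and> v \<in> U)"
        using *(2) E that by (auto simp: I_def independence_complex_def)
      moreover have "\<not> (u \<in> U \<and> v \<in> B)" "\<not> (u \<in> B \<and> v \<in> U)"
        using *(4) E E' that by (auto simp: Bc_def)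
      moreover have "\<not> (u \<in> B \<and> v \<in> B)"
        using indep E by blast
      ultimately show False by blast
    qed
    then show "\<tau> \<in> independence_complex V E"
      using * fin_V[OF *(1)] by (simp add: independence_complex_def)
  qed
  then have scK0: "finite_complex K0"
    using finite_complex_independence_complex[OF fin] by metis

  have fin_Union: "finite (\<Union>K)" if "\<And>\<tau>. \<tau> \<in> K \<Longrightarrow> \<tau> \<subseteq> V" for K
    by (rule finite_subset[OF _ fin]) (use that in blast)
  have scL: "finite_complex (L c)" for c
  proof -
    have "T \<in> L c" if S: "S \<in> L c" "T \<subseteq> S" for S T
    proof -
      have TU: "T \<inter> U \<subseteq> S \<inter> U" and "finite (S \<inter> U)"
        using S fin_V part by (auto simp: L_def)
      then have "card (T \<inter> U) \<le> card (S \<inter> U)"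
        by (simp add: card_mono)
      with S Bc_anti[OF TU] D_down[OF _ TU] show ?thesis
        unfolding L_def by (simp only: mem_Collect_eq) (intro conjI; force)
    qed
    moreover have "finite (\<Union>(L c))"
      by (rule fin_Union) (simp add: L_def)
    ultimately show ?thesis by (simp add: finite_complex_def)
  qed

  \<comment> \<open>When \<open>Bc (\<tau> \<inter> U)\<close> is empty, \<open>\<tau>\<close> has
    no vertex in \<open>B\<close>, so the apex \<open>w\<close> is available.\<close>
  have "collapse_equiv K0 (L 0)"
  proof (rule collapse_equiv_family[OF scK0, where \<Sigma> = "{S\<in>I. Bc S = {}}"])
    have "S \<in> K0" if "S \<in> I" for S
    proof -
      have "S \<inter> U = S" "S \<inter> B = {}" "w \<notin> S" "S \<subseteq> V" using I_sub[OF that] part by auto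
      then show ?thesis using that by (simp add: K0_def)
    qed
    then show "\<Union>{S\<in>I. Bc S = {}} \<subseteq> \<Union>K0" by blast
    show "{} \<notin> {S\<in>I. Bc S = {}}"
      using b0 by (auto simp: Bc_def)
    have bad: "(\<exists>\<sigma>\<in>{S\<in>I. Bc S = {}}. \<sigma> \<subseteq> \<tau>) \<longleftrightarrow> Bc (\<tau> \<inter> U) = {}" if "\<tau> \<in> K0" for \<tau>
    proof
      assume "\<exists>\<sigma>\<in>{S\<in>I. Bc S = {}}. \<sigma> \<subseteq> \<tau>"
      then obtain \<sigma> where \<sigma>: "\<sigma> \<in> I" "Bc \<sigma> = {}" "\<sigma> \<subseteq> \<tau>" by blast
      then show "Bc (\<tau> \<inter> U) = {}"
        using Bc_anti[of \<sigma> "\<tau> \<inter> U"] I_sub[OF \<sigma>(1)] by simp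
    next
      assume "Bc (\<tau> \<inter> U) = {}"
      then show "\<exists>\<sigma>\<in>{S\<in>I. Bc S = {}}. \<sigma> \<subseteq> \<tau>"
        using that by (intro bexI[of _ "\<tau> \<inter> U"]) (auto simp: K0_def)
    qed
    have "L 0 = {\<tau>\<in>K0. Bc (\<tau> \<inter> U) \<noteq> {}}"
      by (auto simp: L_def K0_def D_iff)
    then show "L 0 = {\<tau>\<in>K0. \<forall>\<sigma>\<in>{S\<in>I. Bc S = {}}. \<not> \<sigma> \<subseteq> \<tau>}"
      using bad by (simp only:) meson
    fix \<sigma> assume \<sigma>: "\<sigma> \<in> {S\<in>I. Bc S = {}}"
    show "\<exists>w. w \<notin> \<sigma> \<and> (\<forall>\<tau>\<in>K0. \<sigma> \<subseteq> \<tau> \<longrightarrow> insert w \<tau> \<in> K0 \<and>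
        (\<forall>\<sigma>'\<in>{S\<in>I. Bc S = {}}. \<sigma>' \<subseteq> insert w \<tau> \<longrightarrow> \<sigma>' \<subseteq> \<tau>))"
    proof (intro exI[of _ w] conjI ballI impI)
      show "w \<notin> \<sigma>" using \<sigma> I_sub part by auto
      fix \<tau> assume \<tau>: "\<tau> \<in> K0" "\<sigma> \<subseteq> \<tau>"
      then have "Bc (\<tau> \<inter> U) = {}" using bad[OF \<tau>(1)] \<sigma> by blast
      moreover have "insert w \<tau> \<inter> U = \<tau> \<inter> U" "insert w \<tau> \<inter> B = \<tau> \<inter> B"
        using part by auto
      ultimately show "insert w \<tau> \<in> K0"
        using \<tau>(1) w by (simp add: K0_def)
      fix \<sigma>' assume "\<sigma>' \<in> {S\<in>I. Bc S = {}}" "\<sigma>' \<subseteq> insert w \<tau>"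
      moreover from this have "w \<notin> \<sigma>'" using I_sub part by auto
      ultimately show "\<sigma>' \<subseteq> \<tau>" by blast
    qed
  qed
  \<comment> \<open>The simplices to remove are generated by a set \<open>S\<close> in
    \<open>D\<close> with exactly \<open>c\<close> vertices and one \<open>b\<close> in
    \<open>B\<close> adjacent to some vertex of \<open>S\<close>. Read backwards, these collapses
    are the expansions from \<open>L 0\<close> upwards.\<close>
  moreover have "collapse_equiv (L (Suc c)) (L c)" for c
  proof (rule collapse_equiv_family[OF scL, where \<Sigma> = "{insert b S |b S. S \<in> D \<and> card S = c \<and> b \<in> B - Bc S}"])
    let ?\<Sigma> = "{insert b S |b S. S \<in> D \<and> card S = c \<and> b \<in> B - Bc S}"
    have split: "insert b S \<inter> U = S" "insert b S \<inter> B = {b}" if "S \<in> D" "b \<in> B" for b S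
    proof -
      have "S \<subseteq> U" using that I_sub D_iff by blast
      then show "insert b S \<inter> U = S" "insert b S \<inter> B = {b}"
        using that part by auto
    qed
    have "insert b S \<in> L (Suc c)" if "S \<in> D" "card S = c" "b \<in> B" for b S
    proof -
      have "S \<subseteq> U" using that I_sub D_iff by blast
      then have "insert b S \<subseteq> V" "w \<notin> insert b S" using that part by auto
      then show ?thesis
        using that(1,2) by (simp add: L_def split[OF that(1,3)])
    qed
    then show "\<Union>?\<Sigma> \<subseteq> \<Union>(L (Suc c))" by blast
    show "{} \<notin> ?\<Sigma>" by blast
    show "L c = {\<tau>\<in>L (Suc c). \<forall>\<sigma>\<in>?\<Sigma>. \<not> \<sigma> \<subseteq> \<tau>}"
    proof (intro set_eqI iffI)
      fix \<tau> assume \<tau>: "\<tau> \<in> L c"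
      have "\<not> insert b S \<subseteq> \<tau>" if "S \<in> D" "card S = c" "b \<in> B - Bc S" for b S
      proof
        assume sub: "insert b S \<subseteq> \<tau>"
        then have S: "S \<subseteq> \<tau> \<inter> U" using I_sub[of S] that D_iff by auto
        have "finite (\<tau> \<inter> U)" using part by (intro fin_V) auto
        then have "c \<le> card (\<tau> \<inter> U)" using card_mono[OF _ S] that by simp
        then have "\<tau> \<inter> B \<subseteq> Bc (\<tau> \<inter> U)" using \<tau> by (simp add: L_def)
        then have "b \<in> Bc S" using Bc_anti[OF S] sub that by auto
        then show False using that by blast
      qed
      then show "\<tau> \<in> {\<tau>\<in>L (Suc c). \<forall>\<sigma>\<in>?\<Sigma>. \<not> \<sigma> \<subseteq> \<tau>}"
        using \<tau> by (auto simp: L_def)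
    next
      fix \<tau> assume \<tau>: "\<tau> \<in> {\<tau>\<in>L (Suc c). \<forall>\<sigma>\<in>?\<Sigma>. \<not> \<sigma> \<subseteq> \<tau>}"
      then have L: "\<tau> \<subseteq> V" "\<tau> \<inter> U \<in> D" "w \<in> \<tau> \<Longrightarrow> \<tau> \<inter> B = {}" "Suc c \<le> card (\<tau> \<inter> U) \<Longrightarrow> \<tau> \<inter> B \<subseteq> Bc (\<tau> \<inter> U)"
        by (auto simp: L_def)
      have "\<tau> \<inter> B \<subseteq> Bc (\<tau> \<inter> U)" if "c = card (\<tau> \<inter> U)"
      proof
        fix b assume b: "b \<in> \<tau> \<inter> B"
        show "b \<in> Bc (\<tau> \<inter> U)"
        proof (rule ccontr)
          assume "b \<notin> Bc (\<tau> \<inter> U)"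
          then have "insert b (\<tau> \<inter> U) \<in> ?\<Sigma>"
            using b L(2) that by blast
          moreover have "insert b (\<tau> \<inter> U) \<subseteq> \<tau>" using b by auto
          ultimately show False using \<tau> by blast
        qed
      qed
      then show "\<tau> \<in> L c"
        using L le_neq_implies_less Suc_leI unfolding L_def by (simp only: mem_Collect_eq) metis
    qed
    fix \<sigma> assume "\<sigma> \<in> ?\<Sigma>"
    then obtain b S where \<sigma>: "\<sigma> = insert b S" "S \<in> D" "card S = c" "b \<in> B" "b \<notin> Bc S"
      by blast
    then obtain a where a: "a \<in> Bc S"
      using D_iff by blast
    then have aB: "a \<in> B" using Bc_sub by blast
    have SU: "S \<subseteq> U" using \<sigma>(2) D_iff I_sub by blast
    \<comment> \<open>A larger part in \<open>U\<close> would have at least \<open>Suc c\<close>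
      vertices, and there \<open>L (Suc c)\<close> still forces \<open>b\<close> into
      \<open>Bc S\<close>.\<close>
    have key: "\<tau> \<inter> U = S" if "\<tau> \<in> L (Suc c)" "\<sigma> \<subseteq> \<tau>" for \<tau>
    proof (rule ccontr)
      assume "\<tau> \<inter> U \<noteq> S"
      then have S: "S \<subset> \<tau> \<inter> U" using that(2) \<sigma>(1) SU by blast
      have "finite (\<tau> \<inter> U)" using part by (intro fin_V) auto
      then have "Suc c \<le> card (\<tau> \<inter> U)" using psubset_card_mono[OF _ S] \<sigma>(3) by simp
      then have "\<tau> \<inter> B \<subseteq> Bc (\<tau> \<inter> U)" using that(1) by (simp add: L_def)
      then have "b \<in> Bc S" using Bc_anti[of S "\<tau> \<inter> U"] S that(2) \<sigma>(1,4) by blast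
      then show False using \<sigma>(5) by blast
    qed
    show "\<exists>w. w \<notin> \<sigma> \<and> (\<forall>\<tau>\<in>L (Suc c). \<sigma> \<subseteq> \<tau> \<longrightarrow> insert w \<tau> \<in> L (Suc c) \<and>
        (\<forall>\<sigma>'\<in>?\<Sigma>. \<sigma>' \<subseteq> insert w \<tau> \<longrightarrow> \<sigma>' \<subseteq> \<tau>))"
    \<comment> \<open>The choice of \<open>a\<close> in \<open>Bc S\<close>, and not just in
      \<open>B\<close>, gives order independence: \<open>a\<close> then lies in \<open>Bc S'\<close>
      for every \<open>S' \<subseteq> S\<close>, so adding it cannot supply the offending vertex of
      another member of the family.\<close>
    proof (intro exI[of _ a] conjI ballI impI)
      show "a \<notin> \<sigma>" using a aB \<sigma> SU part by auto
      fix \<tau> assume \<tau>: "\<tau> \<in> L (Suc c)" "\<sigma> \<subseteq> \<tau>"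
      have U: "insert a \<tau> \<inter> U = S" using key[OF \<tau>] aB part by auto
      have "b \<in> \<tau> \<inter> B" using \<tau>(2) \<sigma> by blast
      then have "w \<notin> insert a \<tau>" using \<tau>(1) aB part by (auto simp: L_def)
      moreover have "insert a \<tau> \<subseteq> V" using \<tau>(1) aB part by (auto simp: L_def)
      ultimately show "insert a \<tau> \<in> L (Suc c)"
        using U \<sigma>(2,3) by (simp add: L_def)
      fix \<sigma>' assume "\<sigma>' \<in> ?\<Sigma>" and sub: "\<sigma>' \<subseteq> insert a \<tau>"
      then obtain b' S' where \<sigma>': "\<sigma>' = insert b' S'" "S' \<in> D" "card S' = c" "b' \<in> B" "b' \<notin> Bc S'"
        by blast
      have "S' \<subseteq> U" using \<sigma>'(2) D_iff I_sub by blast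
      then have S': "S' \<subseteq> S" using sub \<sigma>'(1) U by blast
      then have "a \<in> Bc S'" using a Bc_anti by blast
      then have "b' \<noteq> a" using \<sigma>'(5) by blast
      moreover have "S' \<subseteq> \<tau>" using S' \<tau>(2) \<sigma>(1) by blast
      ultimately show "\<sigma>' \<subseteq> \<tau>" using sub \<sigma>'(1) by blast
    qed
  qed
  then have "collapse_equiv (L c) (L 0)" for c
    by (induction c) (auto intro: collapse_refl[OF scL] collapse_trans)
  then have "collapse_equiv (L 0) (L (Suc (card V)))"
    by (rule collapse_sym)
  \<comment> \<open>The part in \<open>B\<close> is now an arbitrary subset of \<open>B\<close>, so
    the star of each other vertex of \<open>B\<close> is a cone with apex \<open>b0\<close>.\<close>
  moreover have "collapse_equiv (L (Suc (card V))) M"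
  proof (rule collapse_equiv_family[OF scL, where \<Sigma> = "{{b} |b. b \<in> B - {b0}}"])
    have small: "card (\<tau> \<inter> U) \<le> card V" for \<tau>
      using part by (intro card_mono fin) auto
    then have L: "\<tau> \<in> L (Suc (card V)) \<longleftrightarrow> \<tau> \<subseteq> V \<and> \<tau> \<inter> U \<in> D \<and> (w \<in> \<tau> \<longrightarrow> \<tau> \<inter> B = {})" for \<tau>
      unfolding L_def using not_less_eq_eq by blast
    have "{} \<in> D"
      using b0 by (auto simp: D independence_complex_def)
    moreover have "{b} \<inter> U = {}" "b \<in> V" "w \<noteq> b" if "b \<in> B" for b
      using that part by auto
    ultimately have "{b} \<in> L (Suc (card V))" if "b \<in> B" for b
      using that unfolding L by simp
    then show "\<Union>{{b} |b. b \<in> B - {b0}} \<subseteq> \<Union>(L (Suc (card V)))" by blast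
    show "{} \<notin> {{b} |b. b \<in> B - {b0}}" by blast
    show "M = {\<tau>\<in>L (Suc (card V)). \<forall>\<sigma>\<in>{{b} |b. b \<in> B - {b0}}. \<not> \<sigma> \<subseteq> \<tau>}"
      unfolding M_def L by blast
    fix \<sigma> assume "\<sigma> \<in> {{b} |b. b \<in> B - {b0}}"
    then obtain b where b: "\<sigma> = {b}" "b \<in> B" "b \<noteq> b0" by blast
    show "\<exists>w. w \<notin> \<sigma> \<and> (\<forall>\<tau>\<in>L (Suc (card V)). \<sigma> \<subseteq> \<tau> \<longrightarrow> insert w \<tau> \<in> L (Suc (card V)) \<and>
        (\<forall>\<sigma>'\<in>{{b} |b. b \<in> B - {b0}}. \<sigma>' \<subseteq> insert w \<tau> \<longrightarrow> \<sigma>' \<subseteq> \<tau>))"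
    proof (intro exI[of _ b0] conjI ballI impI)
      show "b0 \<notin> \<sigma>" using b by simp
      fix \<tau> assume \<tau>: "\<tau> \<in> L (Suc (card V))" "\<sigma> \<subseteq> \<tau>"
      have "insert b0 \<tau> \<inter> U = \<tau> \<inter> U" using b0 part by auto
      moreover have "w \<notin> insert b0 \<tau>" using \<tau> b b0 part unfolding L by auto
      moreover have "insert b0 \<tau> \<subseteq> V" using \<tau> b0 part unfolding L by blast
      ultimately show "insert b0 \<tau> \<in> L (Suc (card V))"
        using \<tau> unfolding L by simp
      fix \<sigma>' assume "\<sigma>' \<in> {{b} |b. b \<in> B - {b0}}" "\<sigma>' \<subseteq> insert b0 \<tau>"
      then show "\<sigma>' \<subseteq> \<tau>" by blast
    qed
  qed
  moreover have "M = {S \<union> W |S W. S \<in> D \<and> W \<in> {{}, {w}, {b0}}}"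
  proof (intro set_eqI iffI)
    fix \<tau> assume \<tau>: "\<tau> \<in> M"
    then have "\<tau> = (\<tau> \<inter> U) \<union> (\<tau> \<inter> {w, b0})" "\<tau> \<inter> {w, b0} \<in> {{}, {w}, {b0}}"
      using part b0 by (auto simp: M_def)
    moreover have "\<tau> \<inter> U \<in> D" using \<tau> by (simp add: M_def)
    ultimately show "\<tau> \<in> {S \<union> W |S W. S \<in> D \<and> W \<in> {{}, {w}, {b0}}}" by blast
  next
    fix \<tau> assume "\<tau> \<in> {S \<union> W |S W. S \<in> D \<and> W \<in> {{}, {w}, {b0}}}"
    then obtain S W where \<tau>: "\<tau> = S \<union> W" "S \<in> D" "W \<in> {{}, {w}, {b0}}" by blast
    moreover from this have "S \<subseteq> U" using D_iff I_sub by blast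
    moreover from this \<tau> have "\<tau> \<inter> U = S" using part b0 by auto
    ultimately show "\<tau> \<in> M"
      using part b0 w unfolding M_def by auto
  qed
  ultimately show ?thesis
    unfolding K0 by (blast intro: collapse_trans)
qed

subsection \<open>Periodicity of circular graphs\<close>

definition gap :: "nat \<Rightarrow> nat \<Rightarrow> nat" where
  "gap u v = (if u \<le> v then v - u else u - v)"

text \<open>Because \<open>n = 2 * r + k + 1\<close>, the substitution \<open>g\<close> to
  \<open>n - g\<close> maps the range from \<open>r + 1\<close> to \<open>r + k\<close> onto itself.
  Hence it does not matter whether the walk from \<open>i\<close> to \<open>j\<close> wraps around,
  and adjacency is symmetric.\<close>

lemma circular_adj_iff_gap:
  assumes n: "n = 2 * r + k + 1" and "i < n" "j < n"
  shows "circular_adj n k i j \<longleftrightarrow> r < gap i j \<and> gap i j \<le> r + k"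
proof -
  have "(n - k - 1) div 2 = r"
    using n by simp
  then have adj: "circular_adj n k i j \<longleftrightarrow> (\<exists>s\<in>{1..k}. j = (i + r + s) mod n)"
    by (simp only: circular_adj_def)
  show ?thesis
  proof
    assume "circular_adj n k i j"
    then obtain s where s: "1 \<le> s" "s \<le> k" "j = (i + r + s) mod n"
      unfolding adj by auto
    show "r < gap i j \<and> gap i j \<le> r + k"
    proof (cases "i + r + s < n")
      case True
      with s show ?thesis by (auto simp: gap_def)
    next
      case False
      then have "j = i + r + s - n"
        using s assms by (simp add: mod_if)
      with s False assms show ?thesis
        by (auto simp: gap_def)
    qed
  next
    assume g: "r < gap i j \<and> gap i j \<le> r + k"
    show "circular_adj n k i j"
    proof (cases "i \<le> j")
      case True
      with g assms show ?thesis
        unfolding adj by (intro bexI[of _ "j - i - r"]) (auto simp: gap_def)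
    next
      case False
      have "i - j \<le> r + k"
        using False g by (simp add: gap_def)
      then have "i + r + (j + n - i - r) = j + n"
        using n by linarith
      then have "j = (i + r + (j + n - i - r)) mod n"
        using assms(3) by simp
      moreover have "j + n - i - r \<in> {1..k}"
        using False g assms by (auto simp: gap_def)
      ultimately show ?thesis
        unfolding adj by blast
    qed
  qed
qed

lemma independence_complex_cong:
  assumes "\<And>u v. u \<in> V \<Longrightarrow> v \<in> V \<Longrightarrow> E u v \<longleftrightarrow> E' u v"
  shows "independence_complex V E = independence_complex V E'"
  unfolding independence_complex_def using assms by (intro Collect_cong) (auto simp: subset_iff)

lemma image_independence_complex:
  assumes bij: "bij_betw f V V'" and E: "\<And>u v. u \<in> V \<Longrightarrow> v \<in> V \<Longrightarrow> E u v \<longleftrightarrow> E' (f u) (f v)"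
  shows "(`) f ` independence_complex V E = independence_complex V' E'"
proof (intro equalityI subsetI)
  fix T assume "T \<in> (`) f ` independence_complex V E"
  then obtain S where S: "T = f ` S" "finite S" "S \<subseteq> V" "\<forall>u\<in>S. \<forall>v\<in>S. \<not> E u v"
    by (auto simp: independence_complex_def)
  then have "\<forall>u\<in>S. \<forall>v\<in>S. \<not> E' (f u) (f v)" "f ` S \<subseteq> V'"
    using E bij by (auto simp: bij_betw_def subset_iff)
  with S show "T \<in> independence_complex V' E'"
    by (auto simp: independence_complex_def)
next
  fix T assume T: "T \<in> independence_complex V' E'"
  define S where "S = V \<inter> f -` T"
  have "T \<subseteq> f ` V"
    using T bij by (simp add: independence_complex_def bij_betw_def)
  then have "f ` S = T" by (auto simp: S_def)
  moreover have "inj_on f S"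
    using bij by (auto simp: S_def bij_betw_def intro: inj_on_subset)
  moreover have "finite T" using T by (simp add: independence_complex_def)
  ultimately have "finite S" using finite_image_iff by metis
  moreover have "\<not> E u v" if "u \<in> S" "v \<in> S" for u v
    using that T E by (simp add: S_def independence_complex_def)
  ultimately have "S \<in> independence_complex V E"
    by (simp add: independence_complex_def S_def)
  with \<open>f ` S = T\<close> show "T \<in> (`) f ` independence_complex V E" by blast
qed

text \<open>Indexed by \<open>r\<close> in place of \<open>n\<close>, because the recursion keeps
  \<open>k\<close> and lowers \<open>r\<close>; this also removes the parity condition and the
  truncated subtraction.\<close>

definition circular_complex :: "nat \<Rightarrow> nat \<Rightarrow> nat set set" where
  "circular_complex r k = independence_complex {..<2 * r + k + 1} (\<lambda>u v. r < gap u v \<and> gap u v \<le> r + k)"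

lemma circular_complex_eq:
  "independence_complex {..<2 * r + k + 1} (circular_adj (2 * r + k + 1) k) = circular_complex r k"
  unfolding circular_complex_def
  by (rule independence_complex_cong) (simp add: circular_adj_iff_gap)

lemma gap_sym: "gap u v = gap v u"
  by (auto simp: gap_def)

lemma gap_self [simp]: "gap u u = 0"
  by (simp add: gap_def)

text \<open>Let \<open>k < r\<close>, let \<open>u\<close> and \<open>u'\<close> lie in
  \<open>{1..r}\<close>, and put \<open>v = r + k + u'\<close>. Then \<open>u\<close> and
  \<open>v\<close> are adjacent iff the residue of \<open>u - u'\<close> modulo \<open>r\<close> is
  less than \<open>k\<close>; the clause \<open>2 * r < gap u v\<close> is the wrap-around. Inside
  either block of \<open>bip_complex\<close> all gaps are below \<open>r\<close>, so there are no
  edges.\<close>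

definition bip_adj :: "nat \<Rightarrow> nat \<Rightarrow> nat \<Rightarrow> nat \<Rightarrow> bool" where
  "bip_adj r k u v \<longleftrightarrow> r < gap u v \<and> gap u v \<le> r + k \<or> 2 * r < gap u v"

definition bip_complex :: "nat \<Rightarrow> nat \<Rightarrow> nat set set" where
  "bip_complex r k = independence_complex ({1..r} \<union> {r+k+1..2*r+k}) (bip_adj r k)"

text \<open>The crossing vertex is \<open>0\<close>. A vertex \<open>b\<close> of its neighbourhood
  \<open>{r+1..r+k}\<close> avoids \<open>u\<close> in the left block iff
  \<open>b \<le> u + r\<close>, and \<open>v\<close> in the right block iff
  \<open>v \<le> b + r\<close>. Upper and lower bounds on \<open>b\<close> can be met together iff
  they are pairwise compatible, that is, \<open>v - u \<le> 2 * r\<close>. This turns the existence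
  of \<open>b\<close> into the extra edges of \<open>bip_adj\<close>.\<close>

lemma circular_complex_crossing:
  assumes k: "1 \<le> k" and r: "k < r"
  shows "collapse_equiv (circular_complex r k) {S \<union> W |S W. S \<in> bip_complex r k \<and> W \<in> {{}, {0}, {r + 1}}}"
  unfolding circular_complex_def
proof (rule collapse_equiv_crossing[where B = "{r+1..r+k}"])
  let ?E = "\<lambda>u v. r < gap u v \<and> gap u v \<le> r + k"
  let ?U = "{1..r} \<union> {r+k+1..2*r+k}"
  show "{r+1..r+k} = {v \<in> {..<2 * r + k + 1}. ?E 0 v}"
    by (auto simp: gap_def)
  have U: "{..<2 * r + k + 1} - insert 0 {r+1..r+k} = ?U"
    by auto
  have "S \<in> independence_complex ?U (bip_adj r k) \<longleftrightarrow>
      S \<in> independence_complex ?U ?E \<and> (\<exists>b\<in>{r+1..r+k}. \<forall>u\<in>S. \<not> ?E u b)" for S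
  proof
    assume S: "S \<in> independence_complex ?U (bip_adj r k)"
    then have SU: "S \<subseteq> ?U" and fin: "finite S" and E: "\<And>u v. u \<in> S \<Longrightarrow> v \<in> S \<Longrightarrow> \<not> bip_adj r k u v"
      by (auto simp: independence_complex_def)
    have "\<exists>b\<in>{r+1..r+k}. \<forall>u\<in>S. \<not> ?E u b"
    proof (cases "S \<inter> {1..r} = {}")
      case True
      have "\<not> ?E u (r + k)" if "u \<in> S" for u
      proof -
        have "u \<in> {r+k+1..2*r+k}" using that True SU by blast
        then show ?thesis by (auto simp: gap_def)
      qed
      then show ?thesis using k by (intro bexI[of _ "r + k"]) auto
    next
      case False
      define i where "i = Min (S \<inter> {1..r})"
      have i: "i \<in> S" "1 \<le> i" "i \<le> r" "\<And>u. u \<in> S \<Longrightarrow> 1 \<le> u \<Longrightarrow> u \<le> r \<Longrightarrow> i \<le> u"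
        using Min_in[OF _ False] fin by (auto simp: i_def)
      \<comment> \<open>The witness is the largest \<open>b\<close> that is not adjacent to any left
        vertex of \<open>S\<close>.\<close>
      have "\<not> ?E u (min (r + i) (r + k))" if "u \<in> S" for u
      proof -
        have "u \<in> {1..r} \<or> u \<in> {r+k+1..2*r+k}" using that SU by blast
        moreover have "gap u i \<le> 2 * r"
          using E[OF that i(1)] by (simp add: bip_adj_def)
        ultimately show ?thesis using i(2,3) i(4)[OF that]
          by (auto simp: gap_def min_def split: if_splits)
      qed
      then show ?thesis using k i by (intro bexI[of _ "min (r + i) (r + k)"]) auto
    qed
    then show "S \<in> independence_complex ?U ?E \<and> (\<exists>b\<in>{r+1..r+k}. \<forall>u\<in>S. \<not> ?E u b)"
      using S by (auto simp: independence_complex_def bip_adj_def)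
  next
    assume "S \<in> independence_complex ?U ?E \<and> (\<exists>b\<in>{r+1..r+k}. \<forall>u\<in>S. \<not> ?E u b)"
    then obtain b where S: "S \<in> independence_complex ?U ?E" and b: "b \<in> {r+1..r+k}" "\<And>u. u \<in> S \<Longrightarrow> \<not> ?E u b"
      by blast
    have "gap u v \<le> 2 * r" if uv: "u \<in> S" "v \<in> S" for u v
    proof -
      have "u \<in> ?U" "v \<in> ?U"
        using S that by (auto simp: independence_complex_def)
      with b(1) b(2)[OF uv(1)] b(2)[OF uv(2)] r show ?thesis
        by (auto simp: gap_def split: if_splits)
    qed
    then have "\<not> bip_adj r k u v" if "u \<in> S" "v \<in> S" for u v
      using S that by (auto simp: independence_complex_def bip_adj_def not_less)
    then show "S \<in> independence_complex ?U (bip_adj r k)"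
      using S by (simp add: independence_complex_def)
  qed
  then show "bip_complex r k = {S \<in> independence_complex ({..<2 * r + k + 1} - insert 0 {r+1..r+k}) ?E.
      \<exists>b\<in>{r+1..r+k}. \<forall>u\<in>S. \<not> ?E u b}"
    unfolding U bip_complex_def by blast
  show "\<not> ?E u v" if "u \<in> {r+1..r+k}" "v \<in> {r+1..r+k}" for u v
    using that r by (auto simp: gap_def)
qed (use k in \<open>auto simp: gap_sym\<close>)

text \<open>The edges added on the left join two vertices whose sets of non-neighbours in
  \<open>{2*r+1..2*r+k}\<close> are disjoint. They arise from the second crossing, at the vertex
  \<open>r\<close>, whose neighbourhood is that set.\<close>

definition half_complex :: "nat \<Rightarrow> nat \<Rightarrow> nat set set" where
  "half_complex r k = independence_complex ({1..<r} \<union> {r+k+1..2*r})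
     (\<lambda>u v. bip_adj r k u v \<or> u < r \<and> v < r \<and> r - k \<le> gap u v)"

text \<open>A vertex \<open>b\<close> of the neighbourhood lies in the right block and so avoids all
  right vertices; it avoids a left vertex \<open>u\<close> iff
  \<open>u + r + k + 1 \<le> b \<le> u + 2 * r\<close>. Intervals that meet pairwise have a common
  point, so a common non-neighbour exists iff no two left vertices have a gap of
  \<open>r - k\<close> or more.\<close>

lemma bip_complex_crossing:
  assumes k: "1 \<le> k" and r: "k < r"
  shows "collapse_equiv (bip_complex r k) {S \<union> W |S W. S \<in> half_complex r k \<and> W \<in> {{}, {r}, {2 * r + 1}}}"
  unfolding bip_complex_def
proof (rule collapse_equiv_crossing[where B = "{2*r+1..2*r+k}"])
  let ?E = "bip_adj r k"
  let ?E' = "\<lambda>u v. bip_adj r k u v \<or> u < r \<and> v < r \<and> r - k \<le> gap u v"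
  let ?U = "{1..<r} \<union> {r+k+1..2*r}"
  show "{2*r+1..2*r+k} = {v \<in> {1..r} \<union> {r+k+1..2*r+k}. ?E r v}"
    using r by (auto simp: gap_def bip_adj_def split: if_splits)
  have U: "{1..r} \<union> {r+k+1..2*r+k} - insert r {2*r+1..2*r+k} = ?U"
    using r by auto
  have "S \<in> independence_complex ?U ?E' \<longleftrightarrow>
      S \<in> independence_complex ?U ?E \<and> (\<exists>b\<in>{2*r+1..2*r+k}. \<forall>u\<in>S. \<not> ?E u b)" for S
  proof
    assume S: "S \<in> independence_complex ?U ?E'"
    then have SU: "S \<subseteq> ?U" and fin: "finite S"
      and E': "\<And>u v. u \<in> S \<Longrightarrow> v \<in> S \<Longrightarrow> \<not> ?E' u v"
      by (auto simp: independence_complex_def)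
    have E: "gap u v < r - k" if "u \<in> S" "v \<in> S" "u < r" "v < r" for u v
      using E'[OF that(1,2)] that(3,4) by auto
    have right: "\<not> ?E u b" if "u \<in> {r+k+1..2*r}" "b \<in> {2*r+1..2*r+k}" for u b
      using that by (auto simp: gap_def bip_adj_def)
    have "\<exists>b\<in>{2*r+1..2*r+k}. \<forall>u\<in>S. \<not> ?E u b"
    proof (cases "S \<inter> {1..<r} = {}")
      case True
      have "\<not> ?E u (2 * r + 1)" if "u \<in> S" for u
        using that True SU k by (intro right) auto
      then show ?thesis using k by (intro bexI[of _ "2 * r + 1"]) auto
    next
      case False
      define i where "i = Max (S \<inter> {1..<r})"
      have i: "i \<in> S" "1 \<le> i" "i < r" "\<And>u. u \<in> S \<Longrightarrow> 1 \<le> u \<Longrightarrow> u < r \<Longrightarrow> u \<le> i"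
        using Max_in[OF _ False] fin by (auto simp: i_def)
      \<comment> \<open>The least \<open>b\<close> that avoids the largest left vertex; the bound on
        gaps keeps it admissible for the smaller ones.\<close>
      define b where "b = max (2 * r + 1) (i + r + k + 1)"
      have b: "b \<in> {2*r+1..2*r+k}" using i k by (auto simp: b_def)
      have "\<not> ?E u b" if "u \<in> S" for u
      proof (cases "u < r")
        case True
        then have "1 \<le> u" using that SU by auto
        then have "u \<le> i" "gap u i < r - k"
          using i True that E by auto
        then show ?thesis
          using True \<open>1 \<le> u\<close> i(3) by (auto simp: gap_def bip_adj_def b_def max_def)
      next
        case False
        then show ?thesis using that SU right[OF _ b] by auto
      qed
      then show ?thesis using b by blast
    qed
    then show "S \<in> independence_complex ?U ?E \<and> (\<exists>b\<in>{2*r+1..2*r+k}. \<forall>u\<in>S. \<not> ?E u b)"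
      using S by (auto simp: independence_complex_def)
  next
    assume "S \<in> independence_complex ?U ?E \<and> (\<exists>b\<in>{2*r+1..2*r+k}. \<forall>u\<in>S. \<not> ?E u b)"
    then obtain b where S: "S \<in> independence_complex ?U ?E" and b: "b \<in> {2*r+1..2*r+k}" "\<And>u. u \<in> S \<Longrightarrow> \<not> ?E u b"
      by blast
    have "gap u v < r - k" if uv: "u \<in> S" "v \<in> S" "u < r" "v < r" for u v
      using b(1) b(2)[OF uv(1)] b(2)[OF uv(2)] r uv(3,4)
      by (auto simp: gap_def bip_adj_def split: if_splits)
    then show "S \<in> independence_complex ?U ?E'"
      using S by (auto simp: independence_complex_def not_le)
  qed
  then show "half_complex r k = {S \<in> independence_complex ({1..r} \<union> {r+k+1..2*r+k} - insert r {2*r+1..2*r+k}) ?E.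
      \<exists>b\<in>{2*r+1..2*r+k}. \<forall>u\<in>S. \<not> ?E u b}"
    unfolding U half_complex_def by blast
  show "\<not> ?E u v" if "u \<in> {2*r+1..2*r+k}" "v \<in> {2*r+1..2*r+k}" for u v
    using that r by (auto simp: gap_def bip_adj_def)
qed (use k r in \<open>auto simp: bip_adj_def gap_sym\<close>)

text \<open>\<open>f\<close> closes the hole of \<open>k + 1\<close> numbers between the blocks and
  starts the numbering at 0. With \<open>q = r - k - 1\<close>, gaps across the blocks drop by
  \<open>k + 1\<close>, so the range from \<open>r + 1\<close> to \<open>r + k\<close> becomes that
  from \<open>q + 1\<close> to \<open>q + k\<close>. On the left, the added edges are exactly the
  gaps above \<open>q\<close>; on the right, all gaps are at most \<open>q\<close>.\<close>

lemma image_half_complex: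
  assumes k: "1 \<le> k" and r: "k < r"
  defines "f \<equiv> \<lambda>v. if v < r then v - 1 else v - k - 2"
  shows "(`) f ` half_complex r k = circular_complex (r - k - 1) k"
    and "inj_on f ({1..<r} \<union> {r+k+1..2*r})"
proof -
  let ?U = "{1..<r} \<union> {r+k+1..2*r}"
  define q where "q = r - k - 1"
  have q: "r = q + k + 1" using r by (simp add: q_def)
  show inj: "inj_on f ?U"
    by (auto simp: inj_on_def f_def)
  have "f ` ?U = {..<2 * q + k + 1}"
  proof (intro equalityI subsetI)
    fix y assume y: "y \<in> {..<2 * q + k + 1}"
    show "y \<in> f ` ?U"
    proof (cases "y + 1 < r")
      case True
      then show ?thesis by (intro image_eqI[of _ _ "y + 1"]) (auto simp: f_def)
    next
      case False
      then show ?thesis using y q by (intro image_eqI[of _ _ "y + k + 2"]) (auto simp: f_def)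
    qed
  qed (auto simp: f_def q)
  then have "bij_betw f ?U {..<2 * q + k + 1}"
    using inj by (simp add: bij_betw_def)
  then show "(`) f ` half_complex r k = circular_complex (r - k - 1) k"
    unfolding half_complex_def circular_complex_def q_def[symmetric]
  proof (rule image_independence_complex)
    fix u v assume "u \<in> ?U" "v \<in> ?U"
    then show "(bip_adj r k u v \<or> u < r \<and> v < r \<and> r - k \<le> gap u v) \<longleftrightarrow>
        q < gap (f u) (f v) \<and> gap (f u) (f v) \<le> q + k"
      using q k by (cases "u < r"; cases "v < r") (auto simp: f_def gap_def bip_adj_def)
  qed
qed

lemma finite_complex_circular_complex: "finite_complex (circular_complex r k)"
  unfolding circular_complex_def by (rule finite_complex_independence_complex) simp

text \<open>In terms of \<open>n\<close>, one period subtracts \<open>2 * (k + 1)\<close> at the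
  cost of two suspensions. This is why the dimension of the sphere goes up by two whenever
  \<open>n / (k + 1)\<close> does.\<close>

lemma circular_complex_periodicity:
  assumes k: "1 \<le> k" and r: "k < r"
  shows "geom_realization (suspend m (circular_complex r k)) homotopy_equivalent_space
    geom_realization (suspend (m + 2) (circular_complex (r - k - 1) k))"
proof -
  have bip: "finite_complex (bip_complex r k)"
    unfolding bip_complex_def by (rule finite_complex_independence_complex) simp
  have half: "finite_complex (half_complex r k)"
    unfolding half_complex_def by (rule finite_complex_independence_complex) simp
  have bipU: "\<Union>(bip_complex r k) \<subseteq> {1..r} \<union> {r+k+1..2*r+k}"
    by (auto simp: bip_complex_def independence_complex_def)
  have halfU: "\<Union>(half_complex r k) \<subseteq> {1..<r} \<union> {r+k+1..2*r}"
    by (auto simp: half_complex_def independence_complex_def)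
  let ?f = "\<lambda>v. if v < r then v - 1 else v - k - 2"
  have "geom_realization (suspend m (circular_complex r k)) homotopy_equivalent_space
      geom_realization (suspend m {S \<union> W |S W. S \<in> bip_complex r k \<and> W \<in> {{}, {0}, {r + 1}}})"
    by (intro collapse_equiv_imp_homotopy_equivalent collapse_equiv_suspend circular_complex_crossing assms)
  also have "\<dots> homotopy_equivalent_space geom_realization (suspend (Suc m) ((`) (\<lambda>x. x) ` bip_complex r k))"
    by (rule homotopy_equivalent_suspend_Suc[OF bip]) (use bipU k in auto)
  also have "(`) (\<lambda>x. x) ` bip_complex r k = bip_complex r k"
    by simp
  also have "geom_realization (suspend (Suc m) (bip_complex r k)) homotopy_equivalent_space
      geom_realization (suspend (Suc m) {S \<union> W |S W. S \<in> half_complex r k \<and> W \<in> {{}, {r}, {2 * r + 1}}})"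
    by (intro collapse_equiv_imp_homotopy_equivalent collapse_equiv_suspend bip_complex_crossing assms)
  also have "\<dots> homotopy_equivalent_space geom_realization (suspend (Suc (Suc m)) ((`) ?f ` half_complex r k))"
    by (rule homotopy_equivalent_suspend_Suc[OF half inj_on_subset[OF image_half_complex(2)[OF assms] halfU]])
      (use halfU r in auto)
  finally show ?thesis
    unfolding image_half_complex(1)[OF assms] by simp
qed

subsection \<open>The circle case\<close>

lemma finite_complex_relation:
  assumes "finite V"
  shows "finite_complex {\<tau>. \<tau> \<subseteq> V \<and> (\<forall>u\<in>\<tau>. \<forall>v\<in>\<tau>. R u v)}"
proof -
  have "finite (\<Union>{\<tau>. \<tau> \<subseteq> V \<and> (\<forall>u\<in>\<tau>. \<forall>v\<in>\<tau>. R u v)})"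
    by (rule finite_subset[OF _ assms]) blast
  then show ?thesis
    unfolding finite_complex_def by blast
qed

text \<open>
  A cycle: the vertex 0 is joined to \<open>a\<close> and to \<open>c\<close>, and the interval from \<open>a\<close> to \<open>c\<close> carries the
  \<open>r\<close>-th power of a path.
\<close>

definition arc_complex :: "nat \<Rightarrow> nat \<Rightarrow> nat \<Rightarrow> nat set set" where
  "arc_complex r a c = {\<tau>. \<tau> \<subseteq> insert 0 {a..c} \<and>
     (\<forall>u\<in>\<tau>. \<forall>v\<in>\<tau>. u < v \<longrightarrow> (if u = 0 then v = a \<or> v = c else v - u \<le> r))}"

lemma arc_complexD:
  assumes "\<tau> \<in> arc_complex r a c" "u \<in> \<tau>" "v \<in> \<tau>" "u < v"
  shows "if u = 0 then v = a \<or> v = c else v - u \<le> r"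
  using assms unfolding arc_complex_def by blast

text \<open>Both cycles are collapses of a common complex \<open>X\<close>, in which
  \<open>0\<close> is joined to \<open>a\<close> and also to \<open>a + 1\<close>. Removing the edge
  from \<open>0\<close> to \<open>a + 1\<close>, with apex \<open>a\<close>, yields the first;
  removing the vertex \<open>a\<close>, with apex \<open>a + 1\<close>, yields the second. The
  distance hypothesis keeps \<open>c\<close> out of the star of that edge.\<close>

lemma arc_complex_shrink:
  assumes r: "1 \<le> r" and a: "1 \<le> a" and ac: "a + r + 2 \<le> c"
  shows "collapse_equiv (arc_complex r a c) (arc_complex r (Suc a) c)"
proof -
  define X where "X = {\<tau>. \<tau> \<subseteq> insert 0 {a..c} \<and>
    (\<forall>u\<in>\<tau>. \<forall>v\<in>\<tau>. u < v \<longrightarrow> (if u = 0 then v = a \<or> v = a + 1 \<or> v = c else v - u \<le> r))}"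
  have X: "finite_complex X"
    unfolding X_def by (rule finite_complex_relation) simp
  have XD: "if u = 0 then v = a \<or> v = a + 1 \<or> v = c else v - u \<le> r"
    if "\<tau> \<in> X" "u \<in> \<tau>" "v \<in> \<tau>" "u < v" for \<tau> u v
    using that unfolding X_def by blast
  have "collapse_equiv X {\<tau>\<in>X. \<not> {0, a + 1} \<subseteq> \<tau>}"
  proof (rule collapse_step[OF X])
    fix \<tau> assume \<tau>: "\<tau> \<in> X" "{0, a + 1} \<subseteq> \<tau>"
    have "x = 0 \<or> x = a \<or> x = a + 1" if x: "x \<in> \<tau>" for x
    proof -
      have "x = 0 \<or> x = a \<or> x = a + 1 \<or> x = c"
        using XD[OF \<tau>(1), of 0 x] x \<tau>(2) by (cases "x = 0") auto
      moreover have "x \<noteq> c"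
      proof
        assume "x = c"
        then have "c - (a + 1) \<le> r"
          using XD[OF \<tau>(1), of "a + 1" x] x \<tau>(2) ac by simp
        then show False using ac by simp
      qed
      ultimately show ?thesis by blast
    qed
    then have sub: "insert a \<tau> \<subseteq> {0, a, a + 1}" by blast
    show "insert a \<tau> \<in> X"
      unfolding X_def
    proof (intro CollectI conjI ballI impI)
      show "insert a \<tau> \<subseteq> insert 0 {a..c}" using sub ac by fastforce
      fix u v assume uv: "u \<in> insert a \<tau>" "v \<in> insert a \<tau>" "u < v"
      then have "u = 0 \<or> u = a \<or> u = a + 1" "v = 0 \<or> v = a \<or> v = a + 1" using sub by blast+
      then show "if u = 0 then v = a \<or> v = a + 1 \<or> v = c else v - u \<le> r"
        using uv(3) r by auto
    qed
  qed (use a in auto)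
  moreover have "{\<tau>\<in>X. \<not> {0, a + 1} \<subseteq> \<tau>} = arc_complex r a c"
  proof (intro set_eqI iffI)
    fix \<tau> assume \<tau>: "\<tau> \<in> {\<tau>\<in>X. \<not> {0, a + 1} \<subseteq> \<tau>}"
    show "\<tau> \<in> arc_complex r a c"
      unfolding arc_complex_def
    proof (intro CollectI conjI ballI impI)
      fix u v assume uv: "u \<in> \<tau>" "v \<in> \<tau>" "u < v"
      then have "\<not> (u = 0 \<and> v = a + 1)"
        using \<tau> by auto
      then show "if u = 0 then v = a \<or> v = c else v - u \<le> r"
        using XD[OF _ uv] \<tau> by auto
    qed (use \<tau> in \<open>auto simp: X_def\<close>)
  next
    fix \<tau> assume \<tau>: "\<tau> \<in> arc_complex r a c"
    have "\<not> {0, a + 1} \<subseteq> \<tau>"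
    proof
      assume "{0, a + 1} \<subseteq> \<tau>"
      then have "a + 1 = a \<or> a + 1 = c"
        using arc_complexD[OF \<tau>, of 0 "a + 1"] by simp
      then show False using ac by simp
    qed
    moreover have "\<tau> \<in> X"
      unfolding X_def
    proof (intro CollectI conjI ballI impI)
      show "\<tau> \<subseteq> insert 0 {a..c}" using \<tau> by (simp add: arc_complex_def)
      fix u v assume "u \<in> \<tau>" "v \<in> \<tau>" "u < v"
      then show "if u = 0 then v = a \<or> v = a + 1 \<or> v = c else v - u \<le> r"
        using arc_complexD[OF \<tau>] by (cases "u = 0") fastforce+
    qed
    ultimately show "\<tau> \<in> {\<tau>\<in>X. \<not> {0, a + 1} \<subseteq> \<tau>}" by blast
  qed
  moreover have "collapse_equiv X {\<tau>\<in>X. \<not> {a} \<subseteq> \<tau>}"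
  proof (rule collapse_step[OF X])
    fix \<tau> assume \<tau>: "\<tau> \<in> X" "{a} \<subseteq> \<tau>"
    have x: "x = 0 \<or> a \<le> x \<and> x \<le> a + r" if "x \<in> \<tau>" for x
    proof (cases "x = 0 \<or> x = a")
      case False
      then have "a < x"
        using that \<tau>(1) by (auto simp: X_def)
      then have "x - a \<le> r"
        using XD[OF \<tau>(1), of a x] that \<tau>(2) a by simp
      then show ?thesis using \<open>a < x\<close> by simp
    qed auto
    show "insert (a + 1) \<tau> \<in> X"
      unfolding X_def
    proof (intro CollectI conjI ballI impI)
      show "insert (a + 1) \<tau> \<subseteq> insert 0 {a..c}"
        using \<tau>(1) ac by (auto simp: X_def)
      fix u v assume uv: "u \<in> insert (a + 1) \<tau>" "v \<in> insert (a + 1) \<tau>" "u < v"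
      then consider "u \<in> \<tau>" "v \<in> \<tau>" | "u = a + 1" "v \<in> \<tau>" | "u \<in> \<tau>" "v = a + 1" by blast
      then show "if u = 0 then v = a \<or> v = a + 1 \<or> v = c else v - u \<le> r"
      proof cases
        case 1
        then show ?thesis using XD[OF \<tau>(1) _ _ uv(3)] by simp
      next
        case 2
        then show ?thesis using x[of v] uv(3) by auto
      next
        case 3
        then show ?thesis using x[of u] uv(3) r by auto
      qed
    qed
  qed auto
  moreover have "{\<tau>\<in>X. \<not> {a} \<subseteq> \<tau>} = arc_complex r (Suc a) c"
  proof (intro set_eqI iffI)
    fix \<tau> assume \<tau>: "\<tau> \<in> {\<tau>\<in>X. \<not> {a} \<subseteq> \<tau>}"
    then have sub: "\<tau> \<subseteq> insert 0 {a..c}" and a\<tau>: "a \<notin> \<tau>" by (auto simp: X_def)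
    show "\<tau> \<in> arc_complex r (Suc a) c"
      unfolding arc_complex_def
    proof (intro CollectI conjI ballI impI)
      show "\<tau> \<subseteq> insert 0 {Suc a..c}"
      proof
        fix x assume "x \<in> \<tau>"
        then have "x \<in> insert 0 {a..c}" "x \<noteq> a" using sub a\<tau> by auto
        then show "x \<in> insert 0 {Suc a..c}" by auto
      qed
      fix u v assume uv: "u \<in> \<tau>" "v \<in> \<tau>" "u < v"
      then have "v \<noteq> a"
        using a\<tau> by blast
      then show "if u = 0 then v = Suc a \<or> v = c else v - u \<le> r"
        using XD[OF _ uv] \<tau> by auto
    qed
  next
    fix \<tau> assume \<tau>: "\<tau> \<in> arc_complex r (Suc a) c"
    then have sub: "\<tau> \<subseteq> insert 0 {Suc a..c}" by (simp add: arc_complex_def)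
    have "\<tau> \<in> X"
      unfolding X_def
    proof (intro CollectI conjI ballI impI)
      show "\<tau> \<subseteq> insert 0 {a..c}" using sub by auto
      fix u v assume "u \<in> \<tau>" "v \<in> \<tau>" "u < v"
      then show "if u = 0 then v = a \<or> v = a + 1 \<or> v = c else v - u \<le> r"
        using arc_complexD[OF \<tau>] by (cases "u = 0") fastforce+
    qed
    moreover have "a \<notin> \<tau>" using sub a by auto
    ultimately show "\<tau> \<in> {\<tau>\<in>X. \<not> {a} \<subseteq> \<tau>}" by blast
  qed
  ultimately have "collapse_equiv X (arc_complex r a c)" "collapse_equiv X (arc_complex r (Suc a) c)"
    by simp_all
  then show ?thesis
    using collapse_sym collapse_trans by blast
qed

text \<open>With \<open>c = a + r + 1\<close>, the only non-adjacent pair among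
  \<open>a, ..., c\<close> is that of the end points, so each inner vertex beyond
  \<open>a + 1\<close> can be removed with apex \<open>a + 1\<close>. The 4-cycle that is left is
  written as the join of the non-adjacent pairs \<open>a, c\<close> and \<open>0, a + 1\<close>, the
  form needed for suspension.\<close>

lemma arc_complex_square:
  assumes r: "1 \<le> r" and a: "1 \<le> a"
  shows "collapse_equiv (arc_complex r a (a + r + 1))
    {S \<union> W |S W. S \<in> {{}, {a}, {a + r + 1}} \<and> W \<in> {{}, {0}, {a + 1}}}"
proof (rule collapse_equiv_family[where \<Sigma> = "{{i} |i. a + 1 < i \<and> i \<le> a + r}"])
  let ?c = "a + r + 1"
  let ?\<Sigma> = "{{i} |i. a + 1 < i \<and> i \<le> a + r}"
  let ?K = "arc_complex r a ?c"
  show "finite_complex ?K"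
    unfolding arc_complex_def by (rule finite_complex_relation) simp
  have "{i} \<in> ?K" if "a + 1 < i" "i \<le> a + r" for i
    using that by (auto simp: arc_complex_def)
  then show "\<Union>?\<Sigma> \<subseteq> \<Union>?K" by blast
  show "{} \<notin> ?\<Sigma>" by blast
  show "{S \<union> W |S W. S \<in> {{}, {a}, {?c}} \<and> W \<in> {{}, {0}, {a + 1}}} = {\<tau>\<in>?K. \<forall>\<sigma>\<in>?\<Sigma>. \<not> \<sigma> \<subseteq> \<tau>}"
  proof (intro set_eqI iffI)
    fix \<tau> assume "\<tau> \<in> {S \<union> W |S W. S \<in> {{}, {a}, {?c}} \<and> W \<in> {{}, {0}, {a + 1}}}"
    then obtain S W where SW: "\<tau> = S \<union> W" "S = {} \<or> S = {a} \<or> S = {?c}" "W = {} \<or> W = {0} \<or> W = {a + 1}"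
      by blast
    then have sub: "x = 0 \<or> x = a \<or> x = a + 1 \<or> x = ?c" if "x \<in> \<tau>" for x
      using that by blast
    have "\<not> (a \<in> \<tau> \<and> ?c \<in> \<tau>)" "\<not> (0 \<in> \<tau> \<and> a + 1 \<in> \<tau>)"
      using SW a r by auto
    then have "if u = 0 then v = a \<or> v = ?c else v - u \<le> r" if "u \<in> \<tau>" "v \<in> \<tau>" "u < v" for u v
      using sub[OF that(1)] sub[OF that(2)] that r by auto
    moreover have "\<tau> \<subseteq> insert 0 {a..?c}"
    proof
      fix x assume "x \<in> \<tau>"
      then show "x \<in> insert 0 {a..?c}" using sub[of x] by auto
    qed
    ultimately have "\<tau> \<in> ?K"
      unfolding arc_complex_def by blast
    moreover have "i \<notin> \<tau>" if "a + 1 < i" "i \<le> a + r" for i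
      using sub[of i] that by auto
    ultimately show "\<tau> \<in> {\<tau>\<in>?K. \<forall>\<sigma>\<in>?\<Sigma>. \<not> \<sigma> \<subseteq> \<tau>}"
      by blast
  next
    fix \<tau> assume \<tau>: "\<tau> \<in> {\<tau>\<in>?K. \<forall>\<sigma>\<in>?\<Sigma>. \<not> \<sigma> \<subseteq> \<tau>}"
    then have \<tau>K: "\<tau> \<in> ?K" and mid: "\<And>i. i \<in> \<tau> \<Longrightarrow> \<not> (a + 1 < i \<and> i \<le> a + r)"
      by blast+
    have sub: "\<tau> \<subseteq> insert 0 {a..?c}"
      using \<tau>K by (simp add: arc_complex_def)
    note adj = arc_complexD[OF \<tau>K]
    have "x = 0 \<or> x = a \<or> x = a + 1 \<or> x = ?c" if "x \<in> \<tau>" for x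
      using sub mid[OF that] that by auto
    then have eq: "\<tau> = (\<tau> \<inter> {a, ?c}) \<union> (\<tau> \<inter> {0, a + 1})" by blast
    have "\<not> (a \<in> \<tau> \<and> ?c \<in> \<tau>)" using adj[of a ?c] a by auto
    then have "\<tau> \<inter> {a, ?c} \<in> {{}, {a}, {?c}}" by auto
    moreover have "\<not> (0 \<in> \<tau> \<and> a + 1 \<in> \<tau>)" using adj[of 0 "a + 1"] r by auto
    then have "\<tau> \<inter> {0, a + 1} \<in> {{}, {0}, {a + 1}}" by auto
    ultimately show "\<tau> \<in> {S \<union> W |S W. S \<in> {{}, {a}, {?c}} \<and> W \<in> {{}, {0}, {a + 1}}}"
      by (intro CollectI exI conjI) (rule eq)
  qed
  fix \<sigma> assume "\<sigma> \<in> ?\<Sigma>"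
  then obtain i where i: "\<sigma> = {i}" "a + 1 < i" "i \<le> a + r" by blast
  show "\<exists>w. w \<notin> \<sigma> \<and> (\<forall>\<tau>\<in>?K. \<sigma> \<subseteq> \<tau> \<longrightarrow> insert w \<tau> \<in> ?K \<and>
        (\<forall>\<sigma>'\<in>?\<Sigma>. \<sigma>' \<subseteq> insert w \<tau> \<longrightarrow> \<sigma>' \<subseteq> \<tau>))"
  proof (intro exI[of _ "a + 1"] conjI ballI impI)
    show "a + 1 \<notin> \<sigma>" using i by simp
    fix \<tau> assume \<tau>: "\<tau> \<in> ?K" "\<sigma> \<subseteq> \<tau>"
    then have sub: "\<tau> \<subseteq> insert 0 {a..?c}"
      by (simp add: arc_complex_def)
    note adj = arc_complexD[OF \<tau>(1)]
    have "0 \<notin> \<tau>" using adj[of 0 i] \<tau>(2) i by auto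
    then have x: "a \<le> x \<and> x \<le> ?c" if "x \<in> \<tau>" for x using sub that by force
    show "insert (a + 1) \<tau> \<in> ?K"
      unfolding arc_complex_def
    proof (intro CollectI conjI ballI impI)
      show "insert (a + 1) \<tau> \<subseteq> insert 0 {a..?c}" using sub r by auto
      fix u v assume uv: "u \<in> insert (a + 1) \<tau>" "v \<in> insert (a + 1) \<tau>" "u < v"
      then consider "u \<in> \<tau>" "v \<in> \<tau>" | "u = a + 1" "v \<in> \<tau>" | "u \<in> \<tau>" "v = a + 1" by blast
      then show "if u = 0 then v = a \<or> v = ?c else v - u \<le> r"
      proof cases
        case 1
        then show ?thesis using adj uv(3) by blast
      next
        case 2
        then show ?thesis using x[of v] uv(3) by auto
      next
        case 3
        then show ?thesis using x[of u] uv(3) r a by auto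
      qed
    qed
    fix \<sigma>' assume "\<sigma>' \<in> ?\<Sigma>" "\<sigma>' \<subseteq> insert (a + 1) \<tau>"
    then show "\<sigma>' \<subseteq> \<tau>" by auto
  qed
qed

lemma arc_complex_collapse_square:
  assumes r: "1 \<le> r" and "1 \<le> a" "a + r + 1 \<le> c"
  shows "\<exists>b\<ge>1. b + 1 < c \<and>
    collapse_equiv (arc_complex r a c) {S \<union> W |S W. S \<in> {{}, {b}, {c}} \<and> W \<in> {{}, {0}, {b + 1}}}"
  using assms(2,3)
proof (induction "c - (a + r + 1)" arbitrary: a)
  case 0
  then have c: "c = a + r + 1" by simp
  show ?case
    unfolding c using arc_complex_square[OF r \<open>1 \<le> a\<close>] 0 r by (intro exI[of _ a]) auto
next
  case (Suc d)
  then have "d = c - (Suc a + r + 1)" "1 \<le> Suc a" "Suc a + r + 1 \<le> c" by auto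
  from Suc(1)[OF this] obtain b where b: "1 \<le> b"
    "collapse_equiv (arc_complex r (Suc a) c) {S \<union> W |S W. S \<in> {{}, {b}, {c}} \<and> W \<in> {{}, {0}, {b + 1}}}" "b + 1 < c"
    by blast
  moreover have "collapse_equiv (arc_complex r a c) (arc_complex r (Suc a) c)"
    using Suc by (intro arc_complex_shrink r) auto
  ultimately show ?case
    using collapse_trans by blast
qed

text \<open>Simplices are the sets of vertices at pairwise cyclic distance at most \<open>r\<close>.
  The circle is first cut at \<open>0\<close>: edges passing over \<open>0\<close> are removed with
  apex \<open>0\<close>. Then every neighbour of \<open>0\<close> except the farthest one on each
  side, \<open>r\<close> and \<open>r + k + 1\<close>, is removed.\<close>

lemma circular_complex_collapse_arc:
  assumes r: "1 \<le> r" and k: "r \<le> k"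
  shows "collapse_equiv (circular_complex r k) (arc_complex r r (r + k + 1))"
proof -
  define n where "n = 2 * r + k + 1"
  define C where "C = {\<tau>. \<tau> \<subseteq> {..<n} \<and> (\<forall>u\<in>\<tau>. \<forall>v\<in>\<tau>. u < v \<longrightarrow> v - u \<le> r \<or> r + k + 1 \<le> v - u)}"
  define C' where "C' = {\<tau>. \<tau> \<subseteq> {..<n} \<and> (\<forall>u\<in>\<tau>. \<forall>v\<in>\<tau>. u < v \<longrightarrow> v - u \<le> r \<or> u = 0 \<and> r + k + 1 \<le> v)}"
  have "circular_complex r k = C"
  proof (intro set_eqI iffI)
    fix \<tau> assume \<tau>: "\<tau> \<in> circular_complex r k"
    show "\<tau> \<in> C"
      unfolding C_def
    proof (intro CollectI conjI ballI impI)
      show "\<tau> \<subseteq> {..<n}" using \<tau> by (simp add: circular_complex_def independence_complex_def n_def)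
      fix u v assume uv: "u \<in> \<tau>" "v \<in> \<tau>" "u < v"
      then have "\<not> (r < gap u v \<and> gap u v \<le> r + k)"
        using \<tau> by (simp add: circular_complex_def independence_complex_def)
      then show "v - u \<le> r \<or> r + k + 1 \<le> v - u"
        using uv(3) by (auto simp: gap_def)
    qed
  next
    fix \<tau> assume \<tau>: "\<tau> \<in> C"
    then have sub: "\<tau> \<subseteq> {..<n}" by (simp add: C_def)
    have "\<not> (r < gap u v \<and> gap u v \<le> r + k)" if uv: "u \<in> \<tau>" "v \<in> \<tau>" for u v
    proof (cases u v rule: linorder_cases)
      case less
      then have "v - u \<le> r \<or> r + k + 1 \<le> v - u" using \<tau> uv by (simp add: C_def)
      with less show ?thesis by (auto simp: gap_def)
    next
      case greater
      then have "u - v \<le> r \<or> r + k + 1 \<le> u - v" using \<tau> uv by (simp add: C_def)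
      with greater show ?thesis by (auto simp: gap_def)
    qed auto
    then show "\<tau> \<in> circular_complex r k"
      using sub finite_subset[OF sub] by (simp add: circular_complex_def independence_complex_def n_def)
  qed
  moreover have "collapse_equiv C C'"
  proof (rule collapse_equiv_family[where \<Sigma> = "{{i, v} |i v. 1 \<le> i \<and> v < n \<and> r + k + 1 \<le> v - i}"])
    let ?\<Sigma> = "{{i, v} |i v. 1 \<le> i \<and> v < n \<and> r + k + 1 \<le> v - i}"
    show "finite_complex C"
      unfolding C_def by (rule finite_complex_relation) simp
    have "{i, v} \<in> C" if "1 \<le> i" "v < n" "r + k + 1 \<le> v - i" for i v
      using that by (auto simp: C_def)
    then show "\<Union>?\<Sigma> \<subseteq> \<Union>C" by blast
    show "{} \<notin> ?\<Sigma>" by blast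
    show "C' = {\<tau>\<in>C. \<forall>\<sigma>\<in>?\<Sigma>. \<not> \<sigma> \<subseteq> \<tau>}"
    proof (intro set_eqI iffI)
      fix \<tau> assume \<tau>: "\<tau> \<in> C'"
      have "\<not> {i, v} \<subseteq> \<tau>" if "1 \<le> i" "r + k + 1 \<le> v - i" for i v
      proof
        assume "{i, v} \<subseteq> \<tau>"
        moreover have "i < v" using that by simp
        ultimately have "v - i \<le> r \<or> i = 0 \<and> r + k + 1 \<le> v"
          using \<tau> by (simp add: C'_def)
        then show False using that by simp
      qed
      moreover have "\<tau> \<in> C"
        using \<tau> by (fastforce simp: C_def C'_def)
      ultimately show "\<tau> \<in> {\<tau>\<in>C. \<forall>\<sigma>\<in>?\<Sigma>. \<not> \<sigma> \<subseteq> \<tau>}" by blast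
    next
      fix \<tau> assume "\<tau> \<in> {\<tau>\<in>C. \<forall>\<sigma>\<in>?\<Sigma>. \<not> \<sigma> \<subseteq> \<tau>}"
      then have \<tau>: "\<tau> \<in> C" "\<And>i v. {i, v} \<subseteq> \<tau> \<Longrightarrow> \<not> (1 \<le> i \<and> v < n \<and> r + k + 1 \<le> v - i)" by blast+
      show "\<tau> \<in> C'"
        unfolding C'_def
      proof (intro CollectI conjI ballI impI)
        show "\<tau> \<subseteq> {..<n}" using \<tau>(1) by (simp add: C_def)
        fix u v assume uv: "u \<in> \<tau>" "v \<in> \<tau>" "u < v"
        then have "v - u \<le> r \<or> r + k + 1 \<le> v - u" "v < n" using \<tau>(1) by (auto simp: C_def)
        moreover have "\<not> (1 \<le> u \<and> v < n \<and> r + k + 1 \<le> v - u)" using \<tau>(2)[of u v] uv by simp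
        ultimately show "v - u \<le> r \<or> u = 0 \<and> r + k + 1 \<le> v" by auto
      qed
    qed
    fix \<sigma> assume "\<sigma> \<in> ?\<Sigma>"
    then obtain i v where \<sigma>: "\<sigma> = {i, v}" "1 \<le> i" "v < n" "r + k + 1 \<le> v - i" by blast
    show "\<exists>w. w \<notin> \<sigma> \<and> (\<forall>\<tau>\<in>C. \<sigma> \<subseteq> \<tau> \<longrightarrow> insert w \<tau> \<in> C \<and>
        (\<forall>\<sigma>'\<in>?\<Sigma>. \<sigma>' \<subseteq> insert w \<tau> \<longrightarrow> \<sigma>' \<subseteq> \<tau>))"
    proof (intro exI[of _ 0] conjI ballI impI)
      show "0 \<notin> \<sigma>" using \<sigma> by simp
      fix \<tau> assume \<tau>: "\<tau> \<in> C" "\<sigma> \<subseteq> \<tau>"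
      then have sub: "\<tau> \<subseteq> {..<n}"
        and adj: "\<And>u v. u \<in> \<tau> \<Longrightarrow> v \<in> \<tau> \<Longrightarrow> u < v \<Longrightarrow> v - u \<le> r \<or> r + k + 1 \<le> v - u"
        by (auto simp: C_def)
      \<comment> \<open>Here \<open>r \<le> k\<close> enters: a vertex not within cyclic distance
        \<open>r\<close> of \<open>0\<close> would lie between \<open>i\<close> and
        \<open>v\<close>, within \<open>r\<close> of both, whence
        \<open>v - i \<le> 2 * r < r + k + 1\<close>.\<close>
      have x: "x \<le> r \<or> r + k + 1 \<le> x" if "x \<in> \<tau>" for x
      proof (rule ccontr)
        assume x: "\<not> (x \<le> r \<or> r + k + 1 \<le> x)"
        have "i \<le> r" "v < n" using \<sigma> by (auto simp: n_def)
        then have "x - i \<le> r \<or> r + k + 1 \<le> x - i" "v - x \<le> r \<or> r + k + 1 \<le> v - x"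
          using adj[of i x] adj[of x v] that \<tau>(2) \<sigma> x by auto
        then show False using x \<sigma> k \<open>i \<le> r\<close> unfolding n_def by linarith
      qed
      show "insert 0 \<tau> \<in> C"
        unfolding C_def
      proof (intro CollectI conjI ballI impI)
        show "insert 0 \<tau> \<subseteq> {..<n}" using sub by (simp add: n_def)
        fix u v assume "u \<in> insert 0 \<tau>" "v \<in> insert 0 \<tau>" "u < v"
        then show "v - u \<le> r \<or> r + k + 1 \<le> v - u"
          using adj[of u v] x[of v] by (cases "u = 0") auto
      qed
      fix \<sigma>' assume \<sigma>': "\<sigma>' \<in> ?\<Sigma>" "\<sigma>' \<subseteq> insert 0 \<tau>"
      then have "0 \<notin> \<sigma>'" by auto
      with \<sigma>'(2) show "\<sigma>' \<subseteq> \<tau>" by blast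
    qed
  qed
  moreover have "collapse_equiv C' (arc_complex r r (r + k + 1))"
  proof (rule collapse_equiv_family[where \<Sigma> = "{{i} |i. 1 \<le> i \<and> i < r \<or> r + k + 1 < i \<and> i < n}"])
    let ?\<Sigma> = "{{i} |i. 1 \<le> i \<and> i < r \<or> r + k + 1 < i \<and> i < n}"
    let ?c = "r + k + 1"
    show "finite_complex C'"
      unfolding C'_def by (rule finite_complex_relation) simp
    have "{i} \<in> C'" if "i < n" for i
      using that by (auto simp: C'_def)
    then have "{..<n} \<subseteq> \<Union>C'" by blast
    moreover have "\<Union>?\<Sigma> \<subseteq> {..<n}" by (auto simp: n_def)
    ultimately show "\<Union>?\<Sigma> \<subseteq> \<Union>C'" by (rule order_trans[rotated])
    show "{} \<notin> ?\<Sigma>" by blast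
    show "arc_complex r r ?c = {\<tau>\<in>C'. \<forall>\<sigma>\<in>?\<Sigma>. \<not> \<sigma> \<subseteq> \<tau>}"
    proof (intro set_eqI iffI)
      fix \<tau> assume \<tau>: "\<tau> \<in> arc_complex r r ?c"
      then have sub: "\<tau> \<subseteq> insert 0 {r..?c}"
        by (simp add: arc_complex_def)
      note adj = arc_complexD[OF \<tau>]
      have "i \<notin> \<tau>" if "1 \<le> i \<and> i < r \<or> ?c < i \<and> i < n" for i
        using that sub by auto
      moreover have "\<tau> \<in> C'"
        unfolding C'_def
      proof (intro CollectI conjI ballI impI)
        show "\<tau> \<subseteq> {..<n}" using sub r by (auto simp: n_def)
        fix u v assume "u \<in> \<tau>" "v \<in> \<tau>" "u < v"
        then show "v - u \<le> r \<or> u = 0 \<and> ?c \<le> v"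
          using adj[of u v] by (auto split: if_splits)
      qed
      ultimately show "\<tau> \<in> {\<tau>\<in>C'. \<forall>\<sigma>\<in>?\<Sigma>. \<not> \<sigma> \<subseteq> \<tau>}" by blast
    next
      fix \<tau> assume "\<tau> \<in> {\<tau>\<in>C'. \<forall>\<sigma>\<in>?\<Sigma>. \<not> \<sigma> \<subseteq> \<tau>}"
      then have \<tau>: "\<tau> \<in> C'" and mid: "\<And>i. i \<in> \<tau> \<Longrightarrow> \<not> (1 \<le> i \<and> i < r \<or> ?c < i \<and> i < n)"
        by blast+
      from \<tau> have sub: "\<tau> \<subseteq> {..<n}"
        and adj: "\<And>u v. u \<in> \<tau> \<Longrightarrow> v \<in> \<tau> \<Longrightarrow> u < v \<Longrightarrow> v - u \<le> r \<or> u = 0 \<and> ?c \<le> v"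
        by (simp_all add: C'_def)
      have x: "x = 0 \<or> r \<le> x \<and> x \<le> ?c" if "x \<in> \<tau>" for x
        using mid[OF that] sub that by auto
      show "\<tau> \<in> arc_complex r r ?c"
        unfolding arc_complex_def
      proof (intro CollectI conjI ballI impI)
        show "\<tau> \<subseteq> insert 0 {r..?c}" using x by fastforce
        fix u v assume "u \<in> \<tau>" "v \<in> \<tau>" "u < v"
        then show "if u = 0 then v = r \<or> v = ?c else v - u \<le> r"
          using adj[of u v] x[of v] by auto
      qed
    qed
    fix \<sigma> assume "\<sigma> \<in> ?\<Sigma>"
    then obtain i where i: "\<sigma> = {i}" "1 \<le> i \<and> i < r \<or> ?c < i \<and> i < n" by blast
    \<comment> \<open>On each side of \<open>0\<close>, the neighbour farthest from \<open>0\<close>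
      is equal or adjacent to everything that the nearer ones are adjacent to.\<close>
    define w where "w = (if i < r then r else ?c)"
    have w: "1 \<le> w" "w < n" using r by (auto simp: w_def n_def)
    show "\<exists>w. w \<notin> \<sigma> \<and> (\<forall>\<tau>\<in>C'. \<sigma> \<subseteq> \<tau> \<longrightarrow> insert w \<tau> \<in> C' \<and>
        (\<forall>\<sigma>'\<in>?\<Sigma>. \<sigma>' \<subseteq> insert w \<tau> \<longrightarrow> \<sigma>' \<subseteq> \<tau>))"
    proof (intro exI[of _ w] conjI ballI impI)
      show "w \<notin> \<sigma>" using i by (auto simp: w_def)
      fix \<tau> assume \<tau>: "\<tau> \<in> C'" "\<sigma> \<subseteq> \<tau>"
      then have sub: "\<tau> \<subseteq> {..<n}"
        and adj: "\<And>u v. u \<in> \<tau> \<Longrightarrow> v \<in> \<tau> \<Longrightarrow> u < v \<Longrightarrow> v - u \<le> r \<or> u = 0 \<and> ?c \<le> v"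
        by (auto simp: C'_def)
      have x: "(w < x \<longrightarrow> x - w \<le> r) \<and> (x < w \<longrightarrow> w - x \<le> r \<or> x = 0 \<and> ?c \<le> w)" if "x \<in> \<tau>" for x
      proof -
        have "i < x \<longrightarrow> x - i \<le> r" "x < i \<longrightarrow> i - x \<le> r \<or> x = 0 \<and> ?c \<le> i"
          using adj[of i x] adj[of x i] that \<tau>(2) i by auto
        moreover have "x < n" using sub that by auto
        ultimately show ?thesis
          using i(2) unfolding w_def n_def by (cases "i < r") auto
      qed
      show "insert w \<tau> \<in> C'"
        unfolding C'_def
      proof (intro CollectI conjI ballI impI)
        show "insert w \<tau> \<subseteq> {..<n}" using sub w by simp
        fix u v assume uv: "u \<in> insert w \<tau>" "v \<in> insert w \<tau>" "u < v"
        then consider "u \<in> \<tau>" "v \<in> \<tau>" | "u = w" "v \<in> \<tau>" | "u \<in> \<tau>" "v = w" by blast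
        then show "v - u \<le> r \<or> u = 0 \<and> ?c \<le> v"
          by cases (use adj x uv(3) in auto)
      qed
      fix \<sigma>' assume \<sigma>': "\<sigma>' \<in> ?\<Sigma>" "\<sigma>' \<subseteq> insert w \<tau>"
      moreover have "w \<notin> \<sigma>'" using \<sigma>'(1) by (auto simp: w_def)
      ultimately show "\<sigma>' \<subseteq> \<tau>" by blast
    qed
  qed
  ultimately show ?thesis
    using collapse_trans by metis
qed

lemma suspend_square:
  fixes a b c w :: 'a
  assumes "a \<noteq> c" "w \<noteq> b" "{a, c} \<inter> {w, b} = {}"
  shows "geom_realization (suspend m {S \<union> W |S W. S \<in> {{}, {a}, {c}} \<and> W \<in> {{}, {w}, {b}}})
    homotopy_equivalent_space geom_realization (suspend (m + 2) {{} :: 'b set})"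
proof -
  have sc: "finite_complex {{}, {a}, {c}}" "finite_complex {{} :: 'a set}"
    by (auto simp: finite_complex_def subset_singleton_iff)
  have "geom_realization (suspend m {S \<union> W |S W. S \<in> {{}, {a}, {c}} \<and> W \<in> {{}, {w}, {b}}})
      homotopy_equivalent_space geom_realization (suspend (Suc m) ((`) (\<lambda>x. x) ` {{}, {a}, {c}}))"
    by (rule homotopy_equivalent_suspend_Suc[OF sc(1)]) (use assms in auto)
  also have "(`) (\<lambda>x. x) ` {{}, {a}, {c}} = {S \<union> W |S W. S \<in> {{}} \<and> W \<in> {{}, {a}, {c}}}"
    by auto
  \<comment> \<open>The base \<open>{{}}\<close> has no vertices, so any function serves as
    relabelling; it only changes the vertex type.\<close>
  also have "geom_realization (suspend (Suc m) \<dots>) homotopy_equivalent_space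
      geom_realization (suspend (Suc (Suc m)) ((`) (\<lambda>_ :: 'a. undefined :: 'b) ` {{}}))"
    by (rule homotopy_equivalent_suspend_Suc[OF sc(2)]) (use assms in auto)
  finally show ?thesis by simp
qed

lemma circular_complex_circle:
  assumes r: "1 \<le> r" and k: "r \<le> k"
  shows "geom_realization (suspend m (circular_complex r k)) homotopy_equivalent_space
    geom_realization (suspend (m + 2) {{} :: nat set})"
proof -
  obtain a where a: "1 \<le> a" "a + 1 < r + k + 1"
    "collapse_equiv (arc_complex r r (r + k + 1)) {S \<union> W |S W. S \<in> {{}, {a}, {r + k + 1}} \<and> W \<in> {{}, {0}, {a + 1}}}"
    using arc_complex_collapse_square[OF r r, of "r + k + 1"] k by auto
  have "geom_realization (suspend m (circular_complex r k)) homotopy_equivalent_space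
      geom_realization (suspend m {S \<union> W |S W. S \<in> {{}, {a}, {r + k + 1}} \<and> W \<in> {{}, {0}, {a + 1}}})"
    using collapse_trans[OF circular_complex_collapse_arc[OF assms] a(3)]
    by (intro collapse_equiv_imp_homotopy_equivalent collapse_equiv_suspend)
  also have "\<dots> homotopy_equivalent_space geom_realization (suspend (m + 2) {{} :: nat set})"
    by (rule suspend_square) (use a in auto)
  finally show ?thesis .
qed

text \<open>Arbitrary \<open>m\<close> is essential for the induction: each period adds 2 to it. The
  quotient of \<open>r\<close> by \<open>k + 1\<close> counts the periods, and the remainder decides
  where the recursion stops.\<close>

lemma circular_complex_reduce:
  assumes k: "1 \<le> k"
  shows "geom_realization (suspend m (circular_complex r k)) homotopy_equivalent_space
    geom_realization (if r mod (k + 1) = 0 then suspend (m + 2 * (r div (k + 1))) (circular_complex 0 k)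
      else suspend (m + 2 * (r div (k + 1)) + 2) {{} :: nat set})"
proof (induction r arbitrary: m rule: less_induct)
  case (less r)
  consider "r = 0" | "1 \<le> r" "r \<le> k" | "k < r" by linarith
  then show ?case
  proof cases
    case 1
    then show ?thesis by (simp add: homotopy_equivalent_space_refl)
  next
    case 2
    then have "r mod (k + 1) \<noteq> 0" "r div (k + 1) = 0" by auto
    then show ?thesis using circular_complex_circle[OF 2] by simp
  next
    case 3
    define q where "q = r - k - 1"
    have q: "r = q + (k + 1)" using 3 by (simp add: q_def)
    have eq: "r mod (k + 1) = q mod (k + 1)" "r div (k + 1) = q div (k + 1) + 1"
      unfolding q by (simp_all only: mod_add_self2 div_add_self2[of "k + 1"] add_is_0 one_neq_zero simp_thms)
    have shift: "m + 2 * (q div (k + 1) + 1) = m + 2 + 2 * (q div (k + 1))"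
      by simp
    have "q < r" using q by simp
    show ?thesis
      unfolding eq shift
      using circular_complex_periodicity[OF k 3, of m, folded q_def] less[OF \<open>q < r\<close>, of "m + 2"]
      by (rule homotopy_eqv_trans)
  qed
qed

subsection \<open>Cross-polytopes and spheres\<close>

text \<open>Of two opposite vertices at most one carries weight at a point of the suspension, so the
  pair of weights is encoded by one real number whose absolute value is their sum.\<close>

definition signed :: "('a + bool \<times> nat \<Rightarrow> real) \<Rightarrow> nat \<Rightarrow> real" where
  "signed x j = x (Inr (True, j)) - x (Inr (False, j))"

text \<open>
  The point of a join with a cross-polytope whose coordinates are proportional to the weights \<open>a\<close>
  on the first factor and to the positive and negative parts of \<open>z\<close> on the second.
\<close>

definition join_point :: "nat \<Rightarrow> 'a set \<Rightarrow> ('a \<Rightarrow> real) \<Rightarrow> (nat \<Rightarrow> real) \<Rightarrow> 'a + bool \<times> nat \<Rightarrow> real" where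
  "join_point m A a z v = case_sum a (\<lambda>(s, j). if s then max 0 (z j) else max 0 (- z j)) v
     / (sum a A + (\<Sum>j<m. \<bar>z j\<bar>))"

lemma join_point_Inl: "join_point m A a z (Inl v) = a v / (sum a A + (\<Sum>j<m. \<bar>z j\<bar>))"
  by (simp add: join_point_def)

lemma signed_join_point: "signed (join_point m A a z) j = z j / (sum a A + (\<Sum>j<m. \<bar>z j\<bar>))"
  by (simp add: join_point_def signed_def max_def diff_divide_distrib[symmetric])

text \<open>\<open>join_point\<close> takes homogeneous coordinates. Positive factors, in particular
  the Euclidean norm in \<open>sphere_normalize\<close>, can therefore be dropped when maps are
  composed.\<close>

lemma join_point_scale:
  assumes "c > 0"
  shows "join_point m A (\<lambda>v. a v / c) (\<lambda>j. z j / c) = join_point m A a z"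
proof
  fix v
  have "sum (\<lambda>v. a v / c) A + (\<Sum>j<m. \<bar>z j / c\<bar>) = (sum a A + (\<Sum>j<m. \<bar>z j\<bar>)) / c"
    using assms by (simp add: sum_divide_distrib add_divide_distrib)
  moreover have "max 0 (x / c) = max 0 x / c" "max 0 (- x / c) = max 0 (- x) / c" for x
    using assms by (auto simp: max_def field_simps)
  ultimately show "join_point m A (\<lambda>v. a v / c) (\<lambda>j. z j / c) v = join_point m A a z v"
    using assms by (simp add: join_point_def split: sum.split)
qed

lemma join_point_cong:
  assumes "\<And>v. a v = a' v" "\<And>j. z j = z' j"
  shows "join_point m A a z = join_point m A a' z'"
  using assms by presburger

lemma Union_suspend_subset:
  assumes "\<Union>K \<subseteq> A"
  shows "\<Union>(suspend m K) \<subseteq> A <+> (UNIV \<times> {..<m})"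
proof
  fix x assume "x \<in> \<Union>(suspend m K)"
  then obtain \<tau> where \<tau>: "x \<in> \<tau>" "Inl -` \<tau> \<in> K" "Inr -` \<tau> \<subseteq> UNIV \<times> {..<m}"
    by (auto simp: suspend_def cross_polytope_def)
  show "x \<in> A <+> (UNIV \<times> {..<m})"
  proof (cases x)
    case (Inl v)
    then have "v \<in> Inl -` \<tau>" using \<tau>(1) by simp
    then show ?thesis using \<tau>(2) assms Inl by blast
  next
    case (Inr v)
    then have "v \<in> Inr -` \<tau>" using \<tau>(1) by simp
    then show ?thesis using \<tau>(3) Inr by blast
  qed
qed

lemma sum_suspend_vertices:
  fixes m :: nat
  assumes "finite A"
  shows "sum x (A <+> (UNIV \<times> {..<m})) = (\<Sum>v\<in>A. x (Inl v)) + (\<Sum>j<m. x (Inr (True, j)) + x (Inr (False, j)))"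
proof -
  have "sum (x \<circ> Inr) (UNIV \<times> {..<m}) = (\<Sum>s\<in>UNIV. \<Sum>j<m. x (Inr (s, j)))"
    by (simp add: sum.cartesian_product)
  also have "\<dots> = (\<Sum>j<m. x (Inr (True, j)) + x (Inr (False, j)))"
    by (simp add: UNIV_bool sum.distrib add.commute)
  finally have "sum (x \<circ> Inr) (UNIV \<times> {..<m}) = (\<Sum>j<m. x (Inr (True, j)) + x (Inr (False, j)))" .
  moreover have "sum x (A <+> (UNIV \<times> {..<m})) = sum (x \<circ> Inl) A + sum (x \<circ> Inr) (UNIV \<times> {..<m})"
    by (rule sum.Plus) (use assms in simp_all)
  ultimately show ?thesis
    by (simp add: o_def)
qed

lemma join_point_in:
  assumes A: "finite A" "\<Union>K \<subseteq> A" and a: "supp a \<in> K" "\<And>v. 0 \<le> a v"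
    and z: "\<And>j. m \<le> j \<Longrightarrow> z j = 0" and N: "sum a A + (\<Sum>j<m. \<bar>z j\<bar>) \<noteq> 0"
  shows "join_point m A a z \<in> topspace (geom_realization (suspend m K))"
proof -
  define N where "N = sum a A + (\<Sum>j<m. \<bar>z j\<bar>)"
  have pos: "N > 0"
  proof -
    have "0 \<le> sum a A" "0 \<le> (\<Sum>j<m. \<bar>z j\<bar>)"
      using a(2) by (auto intro: sum_nonneg)
    then show ?thesis
      using N unfolding N_def by linarith
  qed
  have fin: "finite (A <+> ((UNIV :: bool set) \<times> {..<m}))" using A by simp
  have "Inl -` supp (join_point m A a z) = supp a"
    using pos by (auto simp: join_point_def N_def)
  moreover have "Inr -` supp (join_point m A a z) \<in> cross_polytope m"
  proof -
    have "j < m" if "z j \<noteq> 0" for j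
      using z[of j] that by (cases "m \<le> j") auto
    then show ?thesis
      by (auto simp: cross_polytope_def join_point_def max_def split: if_splits)
  qed
  moreover have "0 \<le> join_point m A a z v" for v
    using pos a(2) by (cases v) (auto simp: join_point_def N_def split: prod.split)
  moreover have "sum (join_point m A a z) (A <+> (UNIV \<times> {..<m})) = 1"
  proof -
    have "max 0 (z j) / N + max 0 (- z j) / N = \<bar>z j\<bar> / N" for j
      by (simp add: max_def)
    then have "sum (join_point m A a z) (A <+> (UNIV \<times> {..<m})) = sum a A / N + (\<Sum>j<m. \<bar>z j\<bar>) / N"
      unfolding sum_suspend_vertices[OF A(1)]
      by (simp add: join_point_def sum_divide_distrib N_def[symmetric])
    then show ?thesis
      using pos by (simp add: add_divide_distrib[symmetric] N_def)
  qed
  ultimately show ?thesis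
    unfolding in_geom_realization_iff[OF fin Union_suspend_subset[OF A(2)]]
    using a(1) by (simp add: suspend_def)
qed

text \<open>Weights on the base together with signed coordinates form a complete coordinate system
  for the suspension: total absolute weight is 1, and \<open>join_point\<close> recovers the
  point.\<close>

lemma in_suspendD:
  assumes A: "finite A" "\<Union>K \<subseteq> A" and x: "x \<in> topspace (geom_realization (suspend m K))"
  shows "{v. x (Inl v) \<noteq> 0} \<in> K" "\<And>v. 0 \<le> x v" "\<And>j. m \<le> j \<Longrightarrow> signed x j = 0"
    "(\<Sum>v\<in>A. x (Inl v)) + (\<Sum>j<m. \<bar>signed x j\<bar>) = 1"
    "join_point m A (\<lambda>v. x (Inl v)) (signed x) = x"
proof -
  have fin: "finite (A <+> ((UNIV :: bool set) \<times> {..<m}))" using A by simp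
  have *: "supp x \<in> suspend m K" "\<And>v. 0 \<le> x v" "sum x (A <+> (UNIV \<times> {..<m})) = 1"
    using x unfolding in_geom_realization_iff[OF fin Union_suspend_subset[OF A(2)]] by blast+
  then show "{v. x (Inl v) \<noteq> 0} \<in> K" "\<And>v. 0 \<le> x v"
    by (auto simp: suspend_def vimage_def)
  have cp: "Inr -` supp x \<in> cross_polytope m"
    using * by (simp add: suspend_def)
  have one: "x (Inr (True, j)) = 0 \<or> x (Inr (False, j)) = 0" for j
    using cp by (auto simp: cross_polytope_def)
  have range: "x (Inr (s, j)) = 0" if "m \<le> j" for s j
    using cp that by (fastforce simp: cross_polytope_def)
  show "signed x j = 0" if "m \<le> j" for j
    using range[OF that] by (simp add: signed_def)
  have abs: "\<bar>signed x j\<bar> = x (Inr (True, j)) + x (Inr (False, j))" for j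
    using one[of j] *(2)[of "Inr (True, j)"] *(2)[of "Inr (False, j)"] by (auto simp: signed_def)
  show sum1: "(\<Sum>v\<in>A. x (Inl v)) + (\<Sum>j<m. \<bar>signed x j\<bar>) = 1"
    using *(3) unfolding sum_suspend_vertices[OF A(1)] abs .
  have "max 0 (signed x j) = x (Inr (True, j))" "max 0 (- signed x j) = x (Inr (False, j))" for j
    using one[of j] *(2)[of "Inr (True, j)"] *(2)[of "Inr (False, j)"] by (auto simp: signed_def)
  then show "join_point m A (\<lambda>v. x (Inl v)) (signed x) = x"
    by (auto simp: join_point_def sum1 fun_eq_iff split: sum.split)
qed

lemma continuous_map_join_point:
  assumes A: "finite A" "\<Union>K \<subseteq> A"
    and cont: "\<And>v. continuous_map X euclideanreal (\<lambda>p. a p v)" "\<And>j. continuous_map X euclideanreal (\<lambda>p. z p j)"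
    and a: "\<And>p. p \<in> topspace X \<Longrightarrow> supp (a p) \<in> K" "\<And>p v. p \<in> topspace X \<Longrightarrow> 0 \<le> a p v"
    and z: "\<And>p j. p \<in> topspace X \<Longrightarrow> m \<le> j \<Longrightarrow> z p j = 0"
    and N: "\<And>p. p \<in> topspace X \<Longrightarrow> sum (a p) A + (\<Sum>j<m. \<bar>z p j\<bar>) \<noteq> 0"
  shows "continuous_map X (geom_realization (suspend m K)) (\<lambda>p. join_point m A (a p) (z p))"
  unfolding continuous_map_into_geom_realization
proof (intro conjI allI ballI)
  have N': "continuous_map X euclideanreal (\<lambda>p. sum (a p) A + (\<Sum>j<m. \<bar>z p j\<bar>))"
    using cont A by (intro continuous_intros) auto
  fix v
  have "continuous_map X euclideanreal (\<lambda>p. case_sum (a p) (\<lambda>(s, j). if s then max 0 (z p j) else max 0 (- z p j)) v)"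
    using cont by (cases v) (auto split: prod.split intro!: continuous_intros)
  then show "continuous_map X euclideanreal (\<lambda>p. join_point m A (a p) (z p) v)"
    unfolding join_point_def using N' N by (intro continuous_map_real_divide) auto
next
  fix p assume "p \<in> topspace X"
  then show "join_point m A (a p) (z p) \<in> topspace (geom_realization (suspend m K))"
    using join_point_in[OF A, of "a p" m "z p"] a z N by simp
qed

lemma continuous_map_signed:
  "continuous_map (geom_realization (suspend m K)) euclideanreal (\<lambda>x. signed x j)"
  unfolding signed_def by (intro continuous_map_diff continuous_map_geom_realization_coordinate)

section \<open>Radial projection onto the sphere\<close>

definition sphere_normalize :: "nat \<Rightarrow> (nat \<Rightarrow> real) \<Rightarrow> nat \<Rightarrow> real" where
  "sphere_normalize d y = (\<lambda>j. y j / sqrt (\<Sum>i\<le>d. (y i)\<^sup>2))"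

lemma in_nsphere_iff: "y \<in> topspace (nsphere d) \<longleftrightarrow> (\<Sum>i\<le>d. (y i)\<^sup>2) = 1 \<and> (\<forall>i>d. y i = 0)"
  by (simp add: nsphere)

lemma sqrt_sum_squares_pos:
  fixes y :: "nat \<Rightarrow> real"
  assumes "\<And>i. d < i \<Longrightarrow> y i = 0" "y i \<noteq> 0"
  shows "0 < sqrt (\<Sum>i\<le>d. (y i)\<^sup>2)"
proof -
  have "i \<le> d" using assms by (cases "d < i") auto
  then have "(y i)\<^sup>2 \<le> (\<Sum>i\<le>d. (y i)\<^sup>2)"
    by (intro member_le_sum) auto
  moreover have "0 < (y i)\<^sup>2" using assms(2) by simp
  ultimately have "0 < (\<Sum>i\<le>d. (y i)\<^sup>2)" by (rule less_le_trans[rotated])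
  then show ?thesis by simp
qed

lemma sphere_normalize_in_nsphere:
  assumes "\<And>i. d < i \<Longrightarrow> y i = 0" "y i \<noteq> 0"
  shows "sphere_normalize d y \<in> topspace (nsphere d)"
proof -
  have "0 < sqrt (\<Sum>i\<le>d. (y i)\<^sup>2)"
    by (rule sqrt_sum_squares_pos) (use assms in auto)
  then have "(\<Sum>i\<le>d. (sphere_normalize d y i)\<^sup>2) = 1"
    by (simp add: sphere_normalize_def power_divide sum_divide_distrib[symmetric])
  then show ?thesis
    using assms(1) by (simp add: in_nsphere_iff sphere_normalize_def)
qed

lemma sphere_normalize_scale: "0 < c \<Longrightarrow> sphere_normalize d (\<lambda>j. y j / c) = sphere_normalize d y"
  by (simp add: sphere_normalize_def power_divide sum_divide_distrib[symmetric] real_sqrt_divide)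

lemma sphere_normalize_nsphere: "y \<in> topspace (nsphere d) \<Longrightarrow> sphere_normalize d y = y"
  by (simp add: sphere_normalize_def in_nsphere_iff)

lemma continuous_map_sphere_normalize:
  assumes "\<And>j. continuous_map X euclideanreal (\<lambda>p. y p j)"
    and "\<And>p i. p \<in> topspace X \<Longrightarrow> d < i \<Longrightarrow> y p i = 0" "\<And>p. p \<in> topspace X \<Longrightarrow> \<exists>i. y p i \<noteq> 0"
  shows "continuous_map X (nsphere d) (\<lambda>p. sphere_normalize d (y p))"
proof -
  have "continuous_map X euclideanreal (\<lambda>p. sphere_normalize d (y p) j)" for j
    unfolding sphere_normalize_def
  proof (rule continuous_map_real_divide)
    show "continuous_map X euclideanreal (\<lambda>p. sqrt (\<Sum>i\<le>d. (y p i)\<^sup>2))"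
      using assms(1) by (intro continuous_intros) auto
    show "sqrt (\<Sum>i\<le>d. (y p i)\<^sup>2) \<noteq> 0" if p: "p \<in> topspace X" for p
    proof -
      obtain i where "y p i \<noteq> 0" using assms(3)[OF p] by blast
      then show ?thesis using sqrt_sum_squares_pos[of d "y p" i] assms(2)[OF p] by simp
    qed
  qed (rule assms(1))
  moreover have "sphere_normalize d (y p) \<in> topspace (nsphere d)" if "p \<in> topspace X" for p
  proof -
    from assms(3)[OF that] obtain i where "y p i \<noteq> 0" by blast
    then show ?thesis
      using sphere_normalize_in_nsphere[of d "y p" i] assms(2)[OF that] by simp
  qed
  ultimately show ?thesis
    unfolding nsphere continuous_map_in_subtopology continuous_map_componentwise_UNIV image_subset_iff
    by (simp add: in_nsphere_iff)
qed

text \<open>Over the base without vertices, the coordinates \<open>signed\<close> identify the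
  realization with the unit sphere of the sum norm in dimension \<open>d + 1\<close>. Radial
  projection takes it homeomorphically onto the Euclidean unit sphere.\<close>

lemma suspend_empty_nsphere:
  "geom_realization (suspend (d + 1) {{} :: nat set}) homotopy_equivalent_space nsphere d"
proof -
  let ?K = "{{} :: nat set}" and ?Y = "geom_realization (suspend (d + 1) {{} :: nat set})"
  have A: "finite ({} :: nat set)" "\<Union>?K \<subseteq> {}" by auto
  let ?f = "\<lambda>x. sphere_normalize d (signed x)" and ?g = "join_point (d + 1) {} (\<lambda>_::nat. 0)"
  note D = in_suspendD[OF A]
  have nz: "\<exists>i. signed x i \<noteq> 0" if "x \<in> topspace ?Y" for x
  proof (rule ccontr)
    assume "\<not> ?thesis"
    then show False using D(4)[OF that] by simp
  qed
  have f: "continuous_map ?Y (nsphere d) ?f"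
    by (rule continuous_map_sphere_normalize) (use nz D(3) in \<open>auto intro: continuous_map_signed\<close>)
  have N: "(\<Sum>j<d + 1. \<bar>y j\<bar>) > 0" if "y \<in> topspace (nsphere d)" for y :: "nat \<Rightarrow> real"
  proof -
    have "\<exists>i\<le>d. y i \<noteq> 0"
    proof (rule ccontr)
      assume "\<not> ?thesis"
      then show False using that by (simp add: in_nsphere_iff)
    qed
    then obtain i where "i \<le> d" "y i \<noteq> 0" by blast
    have "\<bar>y i\<bar> \<le> (\<Sum>j<d + 1. \<bar>y j\<bar>)"
      using \<open>i \<le> d\<close> by (intro member_le_sum) auto
    then show ?thesis using \<open>y i \<noteq> 0\<close> by linarith
  qed
  have g: "continuous_map (nsphere d) ?Y ?g"
    by (rule continuous_map_join_point[OF A]) (use N in \<open>force simp: continuous_map_nsphere_projection in_nsphere_iff\<close>)+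
  have "?g (?f x) = x" if x: "x \<in> topspace ?Y" for x
  proof -
    obtain i where "signed x i \<noteq> 0" using nz[OF x] by blast
    then have "0 < sqrt (\<Sum>i\<le>d. (signed x i)\<^sup>2)"
      using sqrt_sum_squares_pos[of d "signed x" i] D(3)[OF x] by simp
    from join_point_scale[OF this, of "d + 1" "{}" "\<lambda>_::nat. 0" "signed x"]
    have "?g (?f x) = ?g (signed x)" by (simp add: sphere_normalize_def)
    moreover have "(\<lambda>v. x (Inl v)) = (\<lambda>_::nat. 0)" using D(1)[OF x] by auto
    ultimately show ?thesis using D(5)[OF x] by simp
  qed
  moreover have "?f (?g y) = y" if y: "y \<in> topspace (nsphere d)" for y
  proof -
    have "signed (?g y) = (\<lambda>j. y j / (\<Sum>j<d + 1. \<bar>y j\<bar>))"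
      by (rule ext) (simp add: signed_join_point)
    then show ?thesis
      using sphere_normalize_scale[OF N[OF y], of d y] sphere_normalize_nsphere[OF y] by simp
  qed
  ultimately have "homeomorphic_maps ?Y (nsphere d) ?f ?g"
    using f g by (simp add: homeomorphic_maps_def)
  then show ?thesis
    using homeomorphic_imp_homotopy_equivalent_space homeomorphic_space_def by blast
qed

subsection \<open>Wedges of spheres\<close>

text \<open>For \<open>r = 0\<close> the graph is complete, since all gaps on \<open>{..k}\<close>
  are at most \<open>k\<close>.\<close>

lemma circular_complex_0_iff:
  "S \<in> circular_complex 0 k \<longleftrightarrow> S = {} \<or> (\<exists>i\<le>k. S = {i})"
proof
  assume S: "S \<in> circular_complex 0 k"
  then have sub: "S \<subseteq> {..k}" and adj: "\<And>u v. u \<in> S \<Longrightarrow> v \<in> S \<Longrightarrow> \<not> (0 < gap u v \<and> gap u v \<le> k)"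
    by (auto simp: circular_complex_def independence_complex_def)
  have eq: "u = v" if "u \<in> S" "v \<in> S" for u v
  proof -
    have "u \<le> k" "v \<le> k" using that sub by auto
    then show ?thesis using adj[OF that] by (auto simp: gap_def split: if_splits)
  qed
  then show "S = {} \<or> (\<exists>i\<le>k. S = {i})"
  proof (cases "S = {}")
    case False
    then obtain i where "i \<in> S" by blast
    then have "S = {i}" using eq by blast
    then show ?thesis using sub by auto
  qed simp
next
  assume "S = {} \<or> (\<exists>i\<le>k. S = {i})"
  then show "S \<in> circular_complex 0 k"
    by (auto simp: circular_complex_def independence_complex_def)
qed

section \<open>Maps and homotopies on a wedge\<close>

lemma continuous_map_from_sum_topology:
  "continuous_map (sum_topology X I) Y h \<longleftrightarrow> (\<forall>i\<in>I. continuous_map (X i) Y (\<lambda>x. h (i, x)))"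
proof
  assume "continuous_map (sum_topology X I) Y h"
  then show "\<forall>i\<in>I. continuous_map (X i) Y (\<lambda>x. h (i, x))"
    using continuous_map_compose[OF continuous_map_component_injection] by (fastforce simp: o_def)
next
  assume h: "\<forall>i\<in>I. continuous_map (X i) Y (\<lambda>x. h (i, x))"
  show "continuous_map (sum_topology X I) Y h"
    unfolding continuous_map
  proof (intro conjI allI impI)
    show "h ` topspace (sum_topology X I) \<subseteq> topspace Y"
      using h by (force simp: continuous_map)
    fix U assume U: "openin Y U"
    show "openin (sum_topology X I) {x \<in> topspace (sum_topology X I). h x \<in> U}"
      unfolding openin_sum_topology
    proof (intro conjI ballI)
      fix i assume i: "i \<in> I"
      then have "openin (X i) {x \<in> topspace (X i). h (i, x) \<in> U}"
        using h U by (simp add: continuous_map)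
      then show "openin (X i) {x. (i, x) \<in> {x \<in> topspace (sum_topology X I). h x \<in> U}}"
        using i by simp
    qed auto
  qed
qed

abbreviation wedge_map :: "nat \<Rightarrow> (nat \<Rightarrow> real) \<Rightarrow> (nat \<times> (nat \<Rightarrow> real)) option" where
  "wedge_map i y \<equiv> if y = sphere_basepoint then None else Some (i, y)"

lemma wedge_of_spheres_quotient:
  "quotient_map (sum_topology (\<lambda>_. nsphere d) {..<k}) (wedge_of_spheres k d) (\<lambda>(i, y). wedge_map i y)"
  unfolding wedge_of_spheres_def wedge_def by (rule quotient_map_quotient_topology)

lemma continuous_map_wedge_map:
  assumes "i < k"
  shows "continuous_map (nsphere d) (wedge_of_spheres k d) (wedge_map i)"
  using quotient_imp_continuous_map[OF wedge_of_spheres_quotient[of d k]] assms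
  by (simp add: continuous_map_from_sum_topology)

lemma topspace_wedge_of_spheres:
  assumes "p \<in> topspace (wedge_of_spheres k d)"
  obtains i y where "i < k" "y \<in> topspace (nsphere d)" "p = wedge_map i y"
proof -
  have "topspace (wedge_of_spheres k d) = (\<lambda>(i, y). wedge_map i y) ` ({..<k} \<times> topspace (nsphere d))"
    using quotient_imp_surjective_map[OF wedge_of_spheres_quotient[of d k]] by (simp add: o_def)
  with assms that show ?thesis by auto
qed

text \<open>The base points stay fixed at all times, so the homotopies descend to \<open>H\<close>
  on the wedge. Continuity is checked before passing to the quotient: the interval is locally
  compact Hausdorff, so its product with the quotient map is again a quotient map.\<close>

lemma homotopic_wedge_of_spheres:
  assumes h: "\<And>i. i < k \<Longrightarrow> continuous_map (prod_topology (top_of_set {0..1::real}) (nsphere d)) (nsphere d) (h i)"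
    and base: "\<And>i s. i < k \<Longrightarrow> s \<in> {0..1} \<Longrightarrow> h i (s, sphere_basepoint) = sphere_basepoint"
    and f: "\<And>i y. i < k \<Longrightarrow> y \<in> topspace (nsphere d) \<Longrightarrow> f (wedge_map i y) = wedge_map i (h i (0, y))"
    and g: "\<And>i y. i < k \<Longrightarrow> y \<in> topspace (nsphere d) \<Longrightarrow> g (wedge_map i y) = wedge_map i (h i (1, y))"
  shows "homotopic_with (\<lambda>_. True) (wedge_of_spheres k d) (wedge_of_spheres k d) f g"
proof -
  let ?I = "top_of_set {0..1::real}" and ?W = "wedge_of_spheres k d"
  let ?S = "sum_topology (\<lambda>_::nat. nsphere d) {..<k}"
  define H where "H = (\<lambda>(s::real, p). case p of None \<Rightarrow> None | Some (i, y) \<Rightarrow> wedge_map i (h i (s, y)))"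
  have H: "H (s, wedge_map i y) = wedge_map i (h i (s, y))" if "i < k" "s \<in> {0..1}" for s i y
    using base[OF that] by (simp add: H_def)
  have quot: "quotient_map (prod_topology ?I ?S) (prod_topology ?I ?W) (\<lambda>(s, p). (s, (\<lambda>(i, y). wedge_map i y) p))"
    by (rule quotient_map_prod_right[OF _ _ wedge_of_spheres_quotient])
      (auto intro: compact_imp_locally_compact_space Hausdorff_space_subtopology simp: compact_space_subtopology)
  have snd: "continuous_map ?S (nsphere d) snd"
    by (simp add: continuous_map_from_sum_topology)
  have "continuous_map (prod_topology ?I ?S) ?W (H \<circ> (\<lambda>(s, p). (s, (\<lambda>(i, y). wedge_map i y) p)))"
  proof (rule pasting_lemma[where I = "{..<k}" and T = "\<lambda>i. {0..1} \<times> ({i} \<times> topspace (nsphere d))"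
        and f = "\<lambda>i (s, p). wedge_map i (h i (s, snd p))"])
    fix i assume i: "i \<in> {..<k}"
    have "openin ?S ({i} \<times> topspace (nsphere d))"
      unfolding openin_sum_topology
    proof (intro conjI ballI)
      show "openin (nsphere d) {y. (j, y) \<in> {i} \<times> topspace (nsphere d)}" for j
        by (cases "j = i") auto
    qed (use i in auto)
    then show "openin (prod_topology ?I ?S) ({0..1} \<times> ({i} \<times> topspace (nsphere d)))"
      by (simp add: openin_prod_Times_iff)
    have "continuous_map (prod_topology ?I ?S) (prod_topology ?I (nsphere d)) (\<lambda>(s, p). (s, snd p))"
      using continuous_map_compose[OF continuous_map_snd snd, of ?I]
      by (simp add: case_prod_unfold continuous_map_paired continuous_map_fst o_def)
    from continuous_map_compose[OF continuous_map_compose[OF this h] continuous_map_wedge_map]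
    have "continuous_map (prod_topology ?I ?S) ?W (\<lambda>(s, p). wedge_map i (h i (s, snd p)))"
      using i by (simp add: o_def case_prod_unfold)
    then show "continuous_map (subtopology (prod_topology ?I ?S) ({0..1} \<times> ({i} \<times> topspace (nsphere d)))) ?W
        (\<lambda>(s, p). wedge_map i (h i (s, snd p)))"
      by (rule continuous_map_from_subtopology)
  next
    fix x assume "x \<in> topspace (prod_topology ?I ?S)"
    then obtain s i y where x: "x = (s, (i, y))" "s \<in> {0..1}" "i < k" "y \<in> topspace (nsphere d)"
      by auto
    then show "\<exists>j. j \<in> {..<k} \<and> x \<in> {0..1} \<times> ({j} \<times> topspace (nsphere d)) \<and>
        (H \<circ> (\<lambda>(s, p). (s, (\<lambda>(i, y). wedge_map i y) p))) x = (case x of (s, p) \<Rightarrow> wedge_map j (h j (s, snd p)))"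
      using H[of i s y] by (intro exI[of _ i]) (simp add: o_def)
  qed auto
  then have "continuous_map (prod_topology ?I ?W) ?W H"
    by (rule continuous_compose_quotient_map[OF quot])
  moreover have "H (0, p) = f p" "H (1, p) = g p" if "p \<in> topspace ?W" for p
  proof -
    from that obtain i y where "i < k" "y \<in> topspace (nsphere d)" "p = wedge_map i y"
      by (rule topspace_wedge_of_spheres)
    then show "H (0, p) = f p" "H (1, p) = g p"
      using H[of i 0 y] H[of i 1 y] f g by simp_all
  qed
  ultimately show ?thesis
    by (subst homotopic_with) auto
qed

lemma sphere_basepoint_apply: "sphere_basepoint 0 = 1" "sphere_basepoint (Suc j) = 0"
  by (simp_all add: sphere_basepoint_def)

text \<open>Disc \<open>i\<close> is the set of points whose base weight, if any, sits on vertex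
  \<open>i\<close>; its centre has \<open>x (Inl i) = 1\<close> and its boundary
  \<open>x (Inl i) = 0\<close>. The map \<open>f\<close> collapses disc \<open>k\<close> and wraps
  disc \<open>i < k\<close> around the sphere \<open>i\<close>; \<open>g\<close> sends sphere
  \<open>i\<close> onto the union of the discs \<open>i\<close> and \<open>k\<close>. Both are given
  by formulas in coordinates, so that both compositions can be deformed to the identity
  explicitly.\<close>

lemma suspend_points_wedge:
  assumes k: "1 \<le> k"
  shows "geom_realization (suspend d (circular_complex 0 k)) homotopy_equivalent_space wedge_of_spheres k d"
proof -
  let ?K = "circular_complex 0 k" and ?A = "{..k}" and ?W = "wedge_of_spheres k d"
  let ?Y = "geom_realization (suspend d ?K)"
  let ?I = "top_of_set {0..1::real}"
  have A: "finite ?A" "\<Union>?K \<subseteq> ?A"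
    by (auto simp: circular_complex_0_iff)
  note D = in_suspendD[OF A]
  have coord: "continuous_map ?Y euclideanreal (\<lambda>x. x v)" for v
    by (rule continuous_map_geom_realization_coordinate)
  have sgn: "continuous_map ?Y euclideanreal (\<lambda>x. signed x j)" for j
    by (rule continuous_map_signed)
  have disc: "x (Inl j) = 0" if "x \<in> topspace ?Y" "x (Inl i) \<noteq> 0" "j \<noteq> i" for x i j
    using D(1)[OF that(1)] that(2,3) unfolding circular_complex_0_iff by (auto simp: set_eq_iff)
  have beyond: "x (Inl j) = 0" if "x \<in> topspace ?Y" "k < j" for x j
    using D(1)[OF that(1)] that(2) unfolding circular_complex_0_iff
    by (cases "x (Inl j) = 0") (auto simp: set_eq_iff)
  have sumA: "(\<Sum>v\<in>?A. x (Inl v)) = x (Inl i)" if "x \<in> topspace ?Y" "x (Inl i) \<noteq> 0" for x i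
  proof -
    have "i \<le> k" using beyond[OF that(1)] that(2) not_less by blast
    then have "(\<Sum>v\<in>?A. x (Inl v)) = (\<Sum>v\<in>{i}. x (Inl v))"
      using disc[OF that] by (intro sum.mono_neutral_right) auto
    then show ?thesis by simp
  qed
  have some: "\<exists>j. signed x j \<noteq> 0" if "x \<in> topspace ?Y" "(\<Sum>v\<in>?A. x (Inl v)) \<noteq> 1" for x
  proof (rule ccontr)
    assume "\<not> ?thesis"
    then show False using D(4)[OF that(1)] that(2) by simp
  qed

  \<comment> \<open>With \<open>t = x (Inl i)\<close>, the height \<open>1 - 2 * t\<close> runs from
    the base point on the boundary of disc \<open>i\<close> to its antipode at the centre. The
    factor \<open>t\<close> on the other coordinates sends the entire boundary to the base
    point.\<close>
  define V where "V i x j = (case j of 0 \<Rightarrow> 1 - 2 * x (Inl i) | Suc j' \<Rightarrow> x (Inl i) * signed x j')"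
    for i :: nat and x :: "nat + bool \<times> nat \<Rightarrow> real" and j
  \<comment> \<open>\<open>T i\<close> is the union of the discs \<open>i\<close> and
    \<open>k\<close>, given as a zero set and hence closed. For distinct \<open>i, j < k\<close> the
    intersection is disc \<open>k\<close>, where both \<open>F i\<close> and \<open>F j\<close>
    equal the base point, so the pieces can be pasted.\<close>
  define T where "T i = {x \<in> topspace ?Y. (\<Sum>j\<in>{..<k} - {i}. x (Inl j)) = 0}" for i
  have T_iff: "x \<in> T i \<longleftrightarrow> x \<in> topspace ?Y \<and> (\<forall>j<k. j \<noteq> i \<longrightarrow> x (Inl j) = 0)" for x i
  proof (cases "x \<in> topspace ?Y")
    case True
    have "(\<Sum>j\<in>{..<k} - {i}. x (Inl j)) = 0 \<longleftrightarrow> (\<forall>j\<in>{..<k} - {i}. x (Inl j) = 0)"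
      using D(2)[OF True] by (intro sum_nonneg_eq_0_iff) auto
    with True show ?thesis by (auto simp: T_def)
  qed (simp add: T_def)
  have V_beyond: "V i x j = 0" if "x \<in> topspace ?Y" "d < j" for i x j
    using that D(3)[OF that(1)] by (cases j) (auto simp: V_def)
  have V_nonzero: "\<exists>j. V i x j \<noteq> 0" if x: "x \<in> topspace ?Y" for i x
  proof (cases "x (Inl i) = 1 / 2")
    case True
    then have "(\<Sum>v\<in>?A. x (Inl v)) \<noteq> 1" using sumA[OF x, of i] by simp
    from some[OF x this] obtain j where "signed x j \<noteq> 0" by blast
    then show ?thesis using True by (intro exI[of _ "Suc j"]) (simp add: V_def)
  next
    case False
    then show ?thesis by (intro exI[of _ 0]) (simp add: V_def)
  qed
  have V_cont: "continuous_map ?Y euclideanreal (\<lambda>x. V i x j)" for i j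
    unfolding V_def by (cases j) (auto intro!: continuous_intros coord sgn)
  define F where "F i x = sphere_normalize d (V i x)" for i x
  have F_cont: "continuous_map ?Y (nsphere d) (F i)" for i
    unfolding F_def by (rule continuous_map_sphere_normalize[OF V_cont V_beyond V_nonzero])
  have F_base: "F i x = sphere_basepoint" if "x (Inl i) = 0" for i x
  proof -
    have "V i x = sphere_basepoint"
      by (rule ext) (simp add: V_def that sphere_basepoint_def split: nat.split)
    then show ?thesis
      unfolding F_def using sphere_normalize_nsphere[OF sphere_basepoint_in_nsphere] by simp
  qed

  have T_cover: "topspace ?Y \<subseteq> (\<Union>i\<in>{..<k}. T i)"
  proof
    fix x assume x: "x \<in> topspace ?Y"
    show "x \<in> (\<Union>i\<in>{..<k}. T i)"
    proof (cases "\<exists>i<k. x (Inl i) \<noteq> 0")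
      case True
      then obtain i where i: "i < k" "x (Inl i) \<noteq> 0" by blast
      then have "x \<in> T i" using x disc[OF x i(2)] unfolding T_iff by blast
      then show ?thesis using i by blast
    next
      case False
      then have "x \<in> T 0" using x unfolding T_iff by blast
      then show ?thesis using k by (intro UN_I[of 0]) auto
    qed
  qed
  have "closedin ?Y (T i)" for i
  proof -
    have "continuous_map ?Y euclideanreal (\<lambda>x. \<Sum>j\<in>{..<k} - {i}. x (Inl j))"
      by (intro continuous_intros coord) auto
    from closedin_continuous_map_preimage[OF this, of "{0}"] show ?thesis
      by (simp add: T_def)
  qed
  moreover have "continuous_map (subtopology ?Y (T i)) ?W (\<lambda>x. wedge_map i (F i x))" if "i \<in> {..<k}" for i
    using continuous_map_compose[OF F_cont continuous_map_wedge_map] that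
    by (auto simp: o_def intro: continuous_map_from_subtopology)
  moreover have "wedge_map i (F i x) = wedge_map j (F j x)"
    if "i \<in> {..<k}" "j \<in> {..<k}" "x \<in> topspace ?Y \<inter> T i \<inter> T j" for i j x
  proof (cases "i = j")
    case False
    then have "x (Inl i) = 0" "x (Inl j) = 0" using that by (auto simp: T_iff)
    then show ?thesis by (simp add: F_base)
  qed simp
  ultimately obtain f where f_cont: "continuous_map ?Y ?W f"
    and f: "\<And>x i. i < k \<Longrightarrow> x \<in> T i \<Longrightarrow> f x = wedge_map i (F i x)"
  proof (rule pasting_lemma_exists_closed[OF finite_lessThan T_cover])
    fix g assume "continuous_map ?Y ?W g"
      and "\<And>x i. i \<in> {..<k} \<Longrightarrow> x \<in> topspace ?Y \<inter> T i \<Longrightarrow> g x = wedge_map i (F i x)"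
    then show thesis by (intro that[of g]) (auto simp: T_def)
  qed

  \<comment> \<open>The hemisphere with \<open>y 0 < 0\<close> goes to disc \<open>i\<close>, the
    one with \<open>y 0 > 0\<close> to disc \<open>k\<close>. The base point goes to vertex
    \<open>k\<close> for every \<open>i\<close>, so the maps \<open>G i\<close> agree there.\<close>
  define wt where "wt i t j = (if j = i then max 0 (- t) else if j = k then max 0 t else 0)"
    for i j :: nat and t :: real
  define G where "G i y = join_point d ?A (wt i (y 0)) (\<lambda>j. y (Suc j))" for i and y :: "nat \<Rightarrow> real"
  define N where "N y = \<bar>y 0\<bar> + (\<Sum>j<d. \<bar>y (Suc j)\<bar>)" for y :: "nat \<Rightarrow> real"
  have wt_supp: "supp (wt i t) \<in> ?K" if "i < k" for i t
  proof -
    have "supp (wt i t) = (if t < 0 then {i} else if 0 < t then {k} else {})"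
      using that by (auto simp: wt_def)
    then show ?thesis using that by (simp add: circular_complex_0_iff)
  qed
  have wt_nonneg: "0 \<le> wt i t j" for i t j
    by (simp add: wt_def)
  have wt_sum: "sum (wt i t) ?A = \<bar>t\<bar>" if "i < k" for i t
  proof -
    have "sum (wt i t) ?A = sum (wt i t) {i, k}"
      using that by (intro sum.mono_neutral_right) (auto simp: wt_def)
    then show ?thesis using that by (simp add: wt_def max_def)
  qed
  have G_N: "sum (wt i (y 0)) ?A + (\<Sum>j<d. \<bar>y (Suc j)\<bar>) = N y" if "i < k" for i y
    using wt_sum[OF that] by (simp add: N_def)
  have N_pos: "0 < N y" if "\<And>j. d < j \<Longrightarrow> y j = 0" "y i \<noteq> 0" for y i
  proof -
    have "0 \<le> (\<Sum>j<d. \<bar>y (Suc j)\<bar>)" by (rule sum_nonneg) simp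
    show ?thesis
    proof (cases i)
      case 0
      then have "0 < \<bar>y 0\<bar>" using that(2) by simp
      then show ?thesis
        using \<open>0 \<le> (\<Sum>j<d. \<bar>y (Suc j)\<bar>)\<close> unfolding N_def by linarith
    next
      case (Suc j)
      then have "j < d" using that by (cases "j < d") auto
      then have "\<bar>y (Suc j)\<bar> \<le> (\<Sum>j<d. \<bar>y (Suc j)\<bar>)" by (intro member_le_sum) auto
      moreover have "0 < \<bar>y (Suc j)\<bar>" using that(2) Suc by simp
      ultimately show ?thesis unfolding N_def by linarith
    qed
  qed
  have sphere_nz: "\<exists>i. y i \<noteq> 0" if "y \<in> topspace (nsphere d)" for y :: "nat \<Rightarrow> real"
  proof (rule ccontr)
    assume "\<not> ?thesis"
    then show False using that by (simp add: in_nsphere_iff)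
  qed
  have N_sphere: "0 < N y" if "y \<in> topspace (nsphere d)" for y
  proof -
    from sphere_nz[OF that] obtain i where "y i \<noteq> 0" by blast
    then show ?thesis using N_pos[of y i] that by (simp add: in_nsphere_iff)
  qed
  have G_cont: "continuous_map (nsphere d) ?Y (G i)" if i: "i < k" for i
    unfolding G_def
  proof (rule continuous_map_join_point[OF A])
    show "continuous_map (nsphere d) euclideanreal (\<lambda>y. wt i (y 0) v)" for v
      unfolding wt_def by (cases "v = i"; cases "v = k") (auto intro!: continuous_intros continuous_map_nsphere_projection)
    show "continuous_map (nsphere d) euclideanreal (\<lambda>y. y (Suc j))" for j
      by (rule continuous_map_nsphere_projection)
    show "sum (wt i (y 0)) ?A + (\<Sum>j<d. \<bar>y (Suc j)\<bar>) \<noteq> 0" if "y \<in> topspace (nsphere d)" for y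
      using N_sphere[OF that] G_N[OF i] by simp
  qed (use wt_supp[OF i] wt_nonneg in \<open>auto simp: in_nsphere_iff\<close>)
  have G_base: "G i sphere_basepoint = G 0 sphere_basepoint" if "i < k" for i
    unfolding G_def using that k
    by (intro join_point_cong) (auto simp: wt_def sphere_basepoint_apply)
  define g where "g p = (case p of None \<Rightarrow> G 0 sphere_basepoint | Some (i, y) \<Rightarrow> G i y)" for p
  have g: "g (wedge_map i y) = G i y" if "i < k" for i y
    using G_base[OF that] by (simp add: g_def)
  have g_cont: "continuous_map ?W ?Y g"
  proof (rule continuous_compose_quotient_map[OF wedge_of_spheres_quotient])
    show "continuous_map (sum_topology (\<lambda>_. nsphere d) {..<k}) ?Y (g \<circ> (\<lambda>(i, y). wedge_map i y))"
      unfolding continuous_map_from_sum_topology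
    proof
      fix i assume "i \<in> {..<k}"
      then have "i < k" by simp
      then show "continuous_map (nsphere d) ?Y (\<lambda>y. (g \<circ> (\<lambda>(i, y). wedge_map i y)) (i, y))"
        using G_cont[OF \<open>i < k\<close>] by (simp only: o_def prod.case g)
    qed
  qed

  have GT: "G i y \<in> T i" if "i < k" "y \<in> topspace (nsphere d)" for i y
  proof -
    have "G i y \<in> topspace ?Y"
      using G_cont[OF that(1)] that(2) continuous_map_image_subset_topspace by fastforce
    then show ?thesis
      unfolding T_iff using that(1) by (auto simp: G_def join_point_Inl wt_def)
  qed
  have Inl_G: "G i y (Inl i) = max 0 (- y 0) / N y" and signed_G: "signed (G i y) j = y (Suc j) / N y" if "i < k" for i y j
    using that G_N[OF that, of y] by (simp_all add: G_def join_point_Inl signed_join_point wt_def)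

  have "homotopic_with (\<lambda>_. True) ?W ?W id (f \<circ> g)"
  proof (rule homotopic_wedge_of_spheres)
    define h where "h i = (\<lambda>(s, y). sphere_normalize d (\<lambda>j. (1 - s) * y j + s * V i (G i y) j))" for i
    fix i assume i: "i < k"
    \<comment> \<open>Beyond the height, \<open>V i (G i y)\<close> is a nonnegative multiple of
      \<open>y\<close>. For \<open>s < 1\<close> the combination can thus vanish only at a pole, and
      at the poles both heights have the same sign.\<close>
    have nz: "\<exists>j. (1 - s) * y j + s * V i (G i y) j \<noteq> 0"
      if s: "0 \<le> s" "s \<le> 1" and y: "y \<in> topspace (nsphere d)" for s y
    proof (rule ccontr)
      assume "\<not> ?thesis"
      then have z: "(1 - s) * y j + s * V i (G i y) j = 0" for j by blast
      define t where "t = max 0 (- y 0) / N y"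
      have t: "0 \<le> t" using N_sphere[OF y] by (simp add: t_def)
      have "s \<noteq> 1"
      proof
        assume "s = 1"
        then have "V i (G i y) j = 0" for j using z[of j] by simp
        then show False
          using V_nonzero[of "G i y" i] GT[OF i y] by (auto simp: T_def)
      qed
      have "y (Suc j) = 0" for j
      proof -
        have "y (Suc j) * ((1 - s) + s * (t / N y)) = 0"
          using z[of "Suc j"] by (simp add: V_def Inl_G[OF i] signed_G[OF i] t_def[symmetric] algebra_simps)
        moreover have "0 < (1 - s) + s * (t / N y)"
          using s t N_sphere[OF y] \<open>s \<noteq> 1\<close> by (intro add_pos_nonneg) auto
        ultimately show ?thesis by simp
      qed
      moreover from this have y0: "y 0 \<noteq> 0"
        using sphere_nz[OF y] by (metis not0_implies_Suc)
      ultimately have N: "N y = \<bar>y 0\<bar>" by (simp add: N_def)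
      have "(1 - s) * y 0 + s * (1 - 2 * t) = 0"
        using z[of 0] by (simp add: V_def Inl_G[OF i] t_def)
      moreover have "1 - 2 * t = sgn (y 0)"
        using y0 by (cases "y 0 > 0") (auto simp: t_def N)
      ultimately have "(1 - s) * y 0 + s * sgn (y 0) = 0" by simp
      then have "sgn (y 0) * ((1 - s) * \<bar>y 0\<bar> + s) = 0"
        using y0 by (cases "y 0 > 0") (auto simp: algebra_simps)
      moreover have "0 < (1 - s) * \<bar>y 0\<bar> + s"
        using s \<open>s \<noteq> 1\<close> y0 by (intro add_pos_nonneg) auto
      ultimately show False using y0 by (simp add: sgn_0_0)
    qed
    have GY: "continuous_map (prod_topology ?I (nsphere d)) ?Y (\<lambda>p. G i (snd p))"
      using continuous_map_compose[OF continuous_map_snd G_cont[OF i]] by (simp add: o_def)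
    show "continuous_map (prod_topology ?I (nsphere d)) (nsphere d) (h i)"
      unfolding h_def case_prod_unfold
    proof (rule continuous_map_sphere_normalize)
      fix j
      have "continuous_map (prod_topology ?I (nsphere d)) euclideanreal (\<lambda>p. V i (G i (snd p)) j)"
        using continuous_map_compose[OF GY V_cont] by (simp add: o_def)
      moreover have "continuous_map (prod_topology ?I (nsphere d)) euclideanreal (\<lambda>p. snd p j)"
        using continuous_map_compose[OF continuous_map_snd continuous_map_nsphere_projection] by (simp add: o_def)
      ultimately show "continuous_map (prod_topology ?I (nsphere d)) euclideanreal
          (\<lambda>p. (1 - fst p) * snd p j + fst p * V i (G i (snd p)) j)"
        by (intro continuous_intros continuous_map_into_fulltopology[OF continuous_map_fst]) auto
    next
      fix p :: "real \<times> (nat \<Rightarrow> real)" assume p: "p \<in> topspace (prod_topology ?I (nsphere d))"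
      then have y: "snd p \<in> topspace (nsphere d)" "0 \<le> fst p" "fst p \<le> 1" by auto
      show "\<exists>j. (1 - fst p) * snd p j + fst p * V i (G i (snd p)) j \<noteq> 0"
        using nz[OF y(2,3,1)] .
      fix j assume "d < j"
      then show "(1 - fst p) * snd p j + fst p * V i (G i (snd p)) j = 0"
        using y(1) GT[OF i y(1)] V_beyond by (auto simp: in_nsphere_iff T_def)
    qed
    have V_base: "V i (G i sphere_basepoint) = sphere_basepoint"
      by (rule ext) (simp add: V_def Inl_G[OF i] sphere_basepoint_apply sphere_basepoint_def split: nat.split)
    show "h i (s, sphere_basepoint) = sphere_basepoint" if "s \<in> {0..1}" for s
    proof -
      have "(\<lambda>j. (1 - s) * sphere_basepoint j + s * V i (G i sphere_basepoint) j) = sphere_basepoint"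
        by (rule ext) (simp add: V_base algebra_simps)
      then show ?thesis
        using sphere_normalize_nsphere[OF sphere_basepoint_in_nsphere] by (simp add: h_def)
    qed
    fix y assume y: "y \<in> topspace (nsphere d)"
    show "id (wedge_map i y) = wedge_map i (h i (0, y))"
      using sphere_normalize_nsphere[OF y] by (simp add: h_def)
    show "(f \<circ> g) (wedge_map i y) = wedge_map i (h i (1, y))"
      using f[OF i GT[OF i y]] by (simp add: g[OF i] h_def F_def)
  qed
  then have fg: "homotopic_with (\<lambda>_. True) ?W ?W (f \<circ> g) id"
    by (rule homotopic_with_symD)

  define \<alpha> where "\<alpha> x = (\<Sum>j<k. x (Inl j))" for x :: "nat + bool \<times> nat \<Rightarrow> real"
  define a where "a p j = (if j < k then max 0 (snd p (Inl j) * (1 + fst p) - fst p)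
      else if j = k then max 0 (fst p - \<alpha> (snd p) * (1 + fst p)) + (1 - fst p) * snd p (Inl k) else 0)"
    for p :: "real \<times> (nat + bool \<times> nat \<Rightarrow> real)" and j
  define z where "z p j = (1 - fst p + fst p * \<alpha> (snd p)) * signed (snd p) j"
    for p :: "real \<times> (nat + bool \<times> nat \<Rightarrow> real)" and j
  have \<alpha>_disc: "\<alpha> x = x (Inl i)" if "x \<in> T i" "i < k" for x i
  proof -
    have "\<alpha> x = (\<Sum>j\<in>{i}. x (Inl j))"
      unfolding \<alpha>_def using that unfolding T_iff by (intro sum.mono_neutral_right) auto
    then show ?thesis by simp
  qed
  have cover: "\<exists>i<k. x \<in> T i \<and> (x (Inl i) \<noteq> 0 \<longrightarrow> x (Inl k) = 0)" if x: "x \<in> topspace ?Y" for x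
  proof -
    obtain i where i: "i < k" "x \<in> T i"
      using T_cover x by auto
    moreover have "x (Inl i) \<noteq> 0 \<longrightarrow> x (Inl k) = 0" using disc[OF x, of i k] i by simp
    ultimately show ?thesis by blast
  qed
  have a_disc: "a (s, x) j = (if j = i then max 0 (x (Inl i) * (1 + s) - s)
      else if j = k then max 0 (s - x (Inl i) * (1 + s)) + (1 - s) * x (Inl k) else 0)"
    if "x \<in> T i" "i < k" "0 \<le> s" for s x i j
    using that \<alpha>_disc[OF that(1,2)] unfolding T_iff by (auto simp: a_def)
  have "continuous_map (prod_topology ?I ?Y) ?Y (\<lambda>p. join_point d ?A (a p) (z p))"
  proof (rule continuous_map_join_point[OF A])
    have c: "continuous_map (prod_topology ?I ?Y) euclideanreal (\<lambda>p. snd p v)" for v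
      using continuous_map_compose[OF continuous_map_snd coord] by (simp add: o_def)
    have c': "continuous_map (prod_topology ?I ?Y) euclideanreal (\<lambda>p. signed (snd p) j)" for j
      using continuous_map_compose[OF continuous_map_snd sgn] by (simp add: o_def)
    have s: "continuous_map (prod_topology ?I ?Y) euclideanreal fst"
      by (rule continuous_map_into_fulltopology[OF continuous_map_fst])
    have ca: "continuous_map (prod_topology ?I ?Y) euclideanreal (\<lambda>p. \<alpha> (snd p))"
      unfolding \<alpha>_def by (intro continuous_intros c) auto
    show "continuous_map (prod_topology ?I ?Y) euclideanreal (\<lambda>p. a p v)" for v
      unfolding a_def by (cases "v < k"; cases "v = k") (auto intro!: continuous_intros c s ca)
    show "continuous_map (prod_topology ?I ?Y) euclideanreal (\<lambda>p. z p j)" for j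
      unfolding z_def by (intro continuous_intros c' s ca)
    fix p assume "p \<in> topspace (prod_topology ?I ?Y)"
    then obtain s x where p: "p = (s, x)" "0 \<le> s" "s \<le> 1" and x: "x \<in> topspace ?Y" by auto
    obtain i where i: "i < k" "x \<in> T i" "x (Inl i) \<noteq> 0 \<longrightarrow> x (Inl k) = 0"
      using cover[OF x] by blast
    note a = a_disc[OF i(2,1) p(2)]
    have nonneg: "0 \<le> x v" for v using D(2)[OF x] .
    show a_nonneg: "0 \<le> a p v" for v
      unfolding p a using p nonneg by auto
    have pos_i: "a p i = 0 \<or> a p k = 0"
      unfolding p a using i(1,3) p by (cases "x (Inl i) = 0") (auto simp: max_def)
    have other: "a p v = 0" if "v \<noteq> i" "v \<noteq> k" for v
      unfolding p a using that by simp
    show "supp (a p) \<in> ?K"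
    proof -
      have "supp (a p) \<subseteq> {i, k}" using other by blast
      then have "supp (a p) = {} \<or> supp (a p) = {i} \<or> supp (a p) = {k}" using pos_i by blast
      then show ?thesis using i(1) by (auto simp: circular_complex_0_iff)
    qed
    show "z p j = 0" if "d \<le> j" for j
      using D(3)[OF x that] by (simp add: z_def p)
    \<comment> \<open>If both base weights vanish, the original point is not the centre of a disc,
      so some signed coordinate is nonzero; the factor \<open>1 - s + s * \<alpha> x\<close> is then
      positive and keeps it nonzero.\<close>
    show "sum (a p) ?A + (\<Sum>j<d. \<bar>z p j\<bar>) \<noteq> 0"
    proof
      assume 0: "sum (a p) ?A + (\<Sum>j<d. \<bar>z p j\<bar>) = 0"
      have "0 \<le> sum (a p) ?A" "0 \<le> (\<Sum>j<d. \<bar>z p j\<bar>)" using a_nonneg by (auto intro: sum_nonneg)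
      then have "sum (a p) ?A = 0" "(\<Sum>j<d. \<bar>z p j\<bar>) = 0" using 0 by linarith+
      then have "\<forall>v\<in>?A. a p v = 0" "\<forall>j\<in>{..<d}. \<bar>z p j\<bar> = 0"
        using a_nonneg by (simp_all add: sum_nonneg_eq_0_iff)
      then have a0: "a p i = 0" "a p k = 0" and z0: "\<And>j. j < d \<Longrightarrow> z p j = 0"
        using i(1) by auto
      have pos: "0 < 1 - s + s * \<alpha> x" and ne1: "(\<Sum>v\<in>?A. x (Inl v)) \<noteq> 1"
      proof -
        have "0 < 1 - s + s * \<alpha> x \<and> (\<Sum>v\<in>?A. x (Inl v)) \<noteq> 1"
        proof (cases "x (Inl i) = 0")
          case True
          have "a p k = s + (1 - s) * x (Inl k)"
            unfolding p a using i(1) p(2) True by simp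
          moreover have "0 \<le> (1 - s) * x (Inl k)" using p(3) nonneg[of "Inl k"] by simp
          ultimately have "s = 0" "(1 - s) * x (Inl k) = 0" using a0(2) p(2) by linarith+
          then have "x (Inl k) = 0" by simp
          moreover have "x (Inl v) = 0" if "v \<le> k" for v
            using i(2) True that \<open>x (Inl k) = 0\<close> unfolding T_iff by (cases "v = i"; cases "v = k") auto
          ultimately show ?thesis using \<open>s = 0\<close> by simp
        next
          case False
          then have t: "0 < x (Inl i)" using nonneg[of "Inl i"] by simp
          have "x (Inl i) * (1 + s) \<le> s"
            using a0(1) unfolding p a by (simp add: max_def split: if_splits)
          then have "x (Inl i) + x (Inl i) * s \<le> s" by (simp add: algebra_simps)
          moreover have "0 \<le> x (Inl i) * s" using t p(2) by simp
          ultimately have s: "0 < s" using t by linarith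
          then have "0 < x (Inl i) * s" using t by simp
          then have "x (Inl i) \<noteq> 1" "0 < 1 - s + s * x (Inl i)"
            using \<open>x (Inl i) + x (Inl i) * s \<le> s\<close> p(3) by (auto simp: mult.commute)
          then show ?thesis using sumA[OF x False] \<alpha>_disc[OF i(2,1)] by simp
        qed
        then show "0 < 1 - s + s * \<alpha> x" "(\<Sum>v\<in>?A. x (Inl v)) \<noteq> 1" by simp_all
      qed
      from some[OF x ne1] obtain j where j: "signed x j \<noteq> 0" by blast
      then have "j < d" using D(3)[OF x, of j] by (cases "j < d") auto
      then show False using z0[of j] j pos by (simp add: z_def p)
    qed
  qed
  moreover have "join_point d ?A (a (0, x)) (z (0, x)) = id x" if x: "x \<in> topspace ?Y" for x
  proof -
    have nonneg: "0 \<le> x v" for v using D(2)[OF x] .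
    then have "0 \<le> \<alpha> x" unfolding \<alpha>_def by (intro sum_nonneg) auto
    then have "a (0, x) v = x (Inl v)" for v
      using nonneg beyond[OF x, of v] by (simp add: a_def)
    moreover have "z (0, x) j = signed x j" for j
      by (simp add: z_def)
    ultimately have "join_point d ?A (a (0, x)) (z (0, x)) = join_point d ?A (\<lambda>v. x (Inl v)) (signed x)"
      by (rule join_point_cong)
    then show ?thesis using D(5)[OF x] by simp
  qed
  moreover have "join_point d ?A (a (1, x)) (z (1, x)) = (g \<circ> f) x" if x: "x \<in> topspace ?Y" for x
  proof -
    obtain i where i: "i < k" "x \<in> T i"
      using cover[OF x] by blast
    define c where "c = sqrt (\<Sum>i'\<le>d. (V i x i')\<^sup>2)"
    obtain j where "V i x j \<noteq> 0" using V_nonzero[OF x] by blast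
    then have c: "0 < c"
      unfolding c_def using V_beyond[OF x] by (intro sqrt_sum_squares_pos) auto
    have F: "F i x j = V i x j / c" for j
      by (simp add: F_def sphere_normalize_def c_def)
    have wt_scale: "wt i (t / c) v = wt i t v / c" for t v
      using c by (auto simp: wt_def max_def field_simps)
    have "(g \<circ> f) x = join_point d ?A (\<lambda>v. wt i (V i x 0) v / c) (\<lambda>j. V i x (Suc j) / c)"
      unfolding o_def f[OF i] g[OF i(1)] G_def F by (intro join_point_cong wt_scale refl)
    also have "\<dots> = join_point d ?A (wt i (V i x 0)) (\<lambda>j. V i x (Suc j))"
      by (rule join_point_scale[OF c])
    also have "\<dots> = join_point d ?A (a (1, x)) (z (1, x))"
    proof (rule join_point_cong)
      show "wt i (V i x 0) v = a (1, x) v" for v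
        using i(1) by (simp add: a_disc[OF i(2,1)] wt_def V_def mult.commute)
      show "V i x (Suc j) = z (1, x) j" for j
        by (simp add: V_def z_def \<alpha>_disc[OF i(2,1)])
    qed
    finally show ?thesis ..
  qed
  ultimately have "homotopic_with (\<lambda>_. True) ?Y ?Y id (g \<circ> f)"
    by (subst homotopic_with) (auto intro!: exI[of _ "\<lambda>p. join_point d ?A (a p) (z p)"])
  then have gf: "homotopic_with (\<lambda>_. True) ?Y ?Y (g \<circ> f) id"
    by (rule homotopic_with_symD)
  show ?thesis
    unfolding homotopy_equivalent_space_def using f_cont g_cont fg gf by blast
qed

theorem corollary6p5:
  fixes n k :: nat
  assumes "even n \<noteq> even k"
    and "1 \<le> k" and "k \<le> n - 1"
  shows "\<exists>l::nat.
      (n = (2 * l + 1) * (k + 1) \<and>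
        geom_realization (independence_complex {..<n} (circular_adj n k))
          homotopy_equivalent_space wedge_of_spheres k (2 * l))
    \<or> (2 * real l + 1 < real n / (real k + 1) \<and> real n / (real k + 1) < 2 * real l + 3 \<and>
        geom_realization (independence_complex {..<n} (circular_adj n k))
          homotopy_equivalent_space nsphere (2 * l + 1))"
proof -
  \<comment> \<open>Dividing \<open>r\<close> by \<open>k + 1\<close> gives
    \<open>n = (2 * l + 1) * (k + 1) + 2 * q\<close> with \<open>q \<le> k\<close>. So
    \<open>n / (k + 1)\<close> is at least \<open>2 * l + 1\<close> and below
    \<open>2 * l + 3\<close>, with equality on the left exactly for \<open>q = 0\<close>.\<close>
  define r where "r = (n - k - 1) div 2"
  define l where "l = r div (k + 1)"
  define q where "q = r mod (k + 1)"
  have "even (n - k - 1)" using assms by auto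
  then have n: "n = 2 * r + k + 1"
    using assms by (simp add: r_def)
  have r: "r = l * (k + 1) + q" "q < k + 1"
    unfolding l_def q_def by (simp_all only: div_mult_mod_eq) simp
  have "geom_realization (independence_complex {..<n} (circular_adj n k)) = geom_realization (circular_complex r k)"
    unfolding n circular_complex_eq ..
  moreover have "geom_realization (circular_complex r k) homotopy_equivalent_space
      geom_realization (if q = 0 then suspend (2 * l) (circular_complex 0 k) else suspend (2 * l + 2) {{} :: nat set})"
    using homotopy_eqv_trans[OF homotopy_equivalent_suspend_0[OF finite_complex_circular_complex]
        circular_complex_reduce[OF assms(2), of 0 r]]
    unfolding q_def l_def by (simp only: add_0)
  ultimately have red: "geom_realization (independence_complex {..<n} (circular_adj n k)) homotopy_equivalent_space
      geom_realization (if q = 0 then suspend (2 * l) (circular_complex 0 k) else suspend (2 * l + 2) {{} :: nat set})"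
    by simp
  show ?thesis
  proof (cases "q = 0")
    case True
    then have "n = (2 * l + 1) * (k + 1)"
      using n r by (simp add: algebra_simps)
    moreover have "geom_realization (independence_complex {..<n} (circular_adj n k))
        homotopy_equivalent_space wedge_of_spheres k (2 * l)"
      using homotopy_eqv_trans[OF red[unfolded if_P[OF True]] suspend_points_wedge[OF assms(2)]] .
    ultimately show ?thesis by blast
  next
    case False
    have "real n = (2 * real l + 1) * (real k + 1) + 2 * real q"
      unfolding n r(1) by (simp add: algebra_simps)
    moreover have "0 < real q" "real q < real k + 1"
      using False r(2) by simp_all
    ultimately have "2 * real l + 1 < real n / (real k + 1)" "real n / (real k + 1) < 2 * real l + 3"
      by (simp_all add: field_simps)
    moreover have "geom_realization (independence_complex {..<n} (circular_adj n k))
        homotopy_equivalent_space nsphere (2 * l + 1)"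
      using homotopy_eqv_trans[OF red[unfolded if_not_P[OF False]]] suspend_empty_nsphere[of "2 * l + 1"]
      by simp
    ultimately show ?thesis by blast
  qed
qed

end
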